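(* Let $H\subset\mathcal H$ be a closed subspace. 1. If $\mu$ has no atoms and $H$ is finite-dimensional, then $\dim_\mu(H)=0$. 2. If $H=\pi_X(\mathcal H)$ for some $X\in\mathcal B$, then $\dim_\mu(H)=\mu(X)$. 3. Suppose $\mathcal X$ is finite, $\#\mathcal X=J$, and $\mu(X)=\#X/J$ for every $X\subset\mathcal X$. Then for every subspace $H\subset\mathcal H=\mathbb C^J$, $\dim_\mu(H)=\dim(H)/J$, where $\dim$ is the usual dimension of a vector space.
   Context: $(\mathcal X,\mathcal B,\mu)$ is a probability measure space and $\mathcal H=L^2(\mathcal X,\mu)$ (complex-valued). The measure $\mu$ has no atoms if for every $X\in\mathcal B$ with $\mu(X)>0$ there is $Y\in\mathcal B$, $Y\subset X$, with $0<\mu(Y)<\mu(X)$. For $X\in\mathcal B$, $\pi_X:\mathcal H\to\mathcal H$ is the orthogonal projector $\pi_Xf=\mathbf 1_X f$. A partition is a finite family $\chi=\{Y_1,\dots,Y_n\}\subset\mathcal B$ with $\mu(\mathcal X\setminus\bigcup_j Y_j)=0$ and $\mu(Y_j\cap Y_k)=0$ for $j\ne k$. For a bounded operator $W$ on $\mathcal H$ with operator norm $\|W\|$, put $\mathcal M_\chi(W)=\sum_{j}\mu(Y_j)\|W\pi_{Y_j}\|^2$, and define the $\mu$-norm $\|W\|_\mu=\inf_\chi\sqrt{\mathcal M_\chi(W)}$, the infimum being over all partitions $\chi$. For a closed subspace $H\subset\mathcal H$ with orthogonal projector $\pi_H$ onto $H$ (regarded as an operator on $\mathcal H$), the $\mu$-dimension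 is $\dim_\mu(H)=\|\pi_H\|_\mu^2$. *)

theory Defs
  imports "HOL-Probability.Probability" "Jordan_Normal_Form.VS_Connect"
begin

text \<open>The Hilbert space \<open>L\<^sup>2(M)\<close> of a measure \<open>M\<close>, as a complex vector space in the sense of
  HOL-Algebra whose vectors are the almost-everywhere classes of measurable square-integrable
  functions.\<close>

definition sq_integrable :: "'a measure \<Rightarrow> ('a \<Rightarrow> complex) set" where
  "sq_integrable M = {f \<in> borel_measurable M. integrable M (\<lambda>x. (cmod (f x))\<^sup>2)}"

definition L2_rel :: "'a measure \<Rightarrow> (('a \<Rightarrow> complex) \<times> ('a \<Rightarrow> complex)) set" where
  "L2_rel M = {(f, g). f \<in> sq_integrable M \<and> g \<in> sq_integrable M \<and> (AE x in M. f x = g x)}"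

abbreviation L2_class :: "'a measure \<Rightarrow> ('a \<Rightarrow> complex) \<Rightarrow> ('a \<Rightarrow> complex) set" where
  "L2_class M f \<equiv> L2_rel M `` {f}"

definition L2_rep :: "('a \<Rightarrow> complex) set \<Rightarrow> 'a \<Rightarrow> complex" where
  "L2_rep u = (SOME f. f \<in> u)"

text \<open>The \<open>mult\<close> and \<open>one\<close> fields, which a module record inherits from rings, carry no meaning.\<close>

definition L2 :: "'a measure \<Rightarrow> (complex, ('a \<Rightarrow> complex) set) module" where
  "L2 M = \<lparr>carrier = sq_integrable M // L2_rel M,
     mult = undefined, one = undefined,
     zero = L2_class M (\<lambda>x. 0),
     add = (\<lambda>u v. L2_class M (\<lambda>x. L2_rep u x + L2_rep v x)),
     smult = (\<lambda>c u. L2_class M (\<lambda>x. c * L2_rep u x))\<rparr>"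

definition L2_inner :: "'a measure \<Rightarrow> ('a \<Rightarrow> complex) set \<Rightarrow> ('a \<Rightarrow> complex) set \<Rightarrow> complex" where
  "L2_inner M u v = (\<integral>x. L2_rep u x * cnj (L2_rep v x) \<partial>M)"

definition L2_norm :: "'a measure \<Rightarrow> ('a \<Rightarrow> complex) set \<Rightarrow> real" where
  "L2_norm M u = sqrt (\<integral>x. (cmod (L2_rep u x))\<^sup>2 \<partial>M)"

definition L2_dist :: "'a measure \<Rightarrow> ('a \<Rightarrow> complex) set \<Rightarrow> ('a \<Rightarrow> complex) set \<Rightarrow> real" where
  "L2_dist M u v = sqrt (\<integral>x. (cmod (L2_rep u x - L2_rep v x))\<^sup>2 \<partial>M)"

abbreviation L2_subspace :: "'a measure \<Rightarrow> ('a \<Rightarrow> complex) set set \<Rightarrow> bool" where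
  "L2_subspace M H \<equiv> VectorSpace.subspace class_ring H (L2 M)"

definition L2_closed_subspace :: "'a measure \<Rightarrow> ('a \<Rightarrow> complex) set set \<Rightarrow> bool" where
  "L2_closed_subspace M H \<longleftrightarrow>
     L2_subspace M H \<and> closedin (Metric_space.mtopology (carrier (L2 M)) (L2_dist M)) H"

abbreviation L2_sub :: "'a measure \<Rightarrow> ('a \<Rightarrow> complex) set set \<Rightarrow> (complex, ('a \<Rightarrow> complex) set) module"
  where "L2_sub M H \<equiv> (L2 M)\<lparr>carrier := H\<rparr>"

definition L2_proj ::
    "'a measure \<Rightarrow> ('a \<Rightarrow> complex) set set \<Rightarrow> ('a \<Rightarrow> complex) set \<Rightarrow> ('a \<Rightarrow> complex) set" where
  "L2_proj M H u = (THE v. v \<in> H \<and> (\<forall>w\<in>H. L2_inner M (u \<ominus>\<^bsub>L2 M\<^esub> v) w = 0))"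

definition L2_indicator_proj ::
    "'a measure \<Rightarrow> 'a set \<Rightarrow> ('a \<Rightarrow> complex) set \<Rightarrow> ('a \<Rightarrow> complex) set" where
  "L2_indicator_proj M X u = L2_class M (\<lambda>x. indicator X x * L2_rep u x)"

text \<open>The supremum is taken in the reals, so the following is the operator norm for bounded operators
  only.\<close>

definition L2_opnorm :: "'a measure \<Rightarrow> (('a \<Rightarrow> complex) set \<Rightarrow> ('a \<Rightarrow> complex) set) \<Rightarrow> real" where
  "L2_opnorm M W = Sup {L2_norm M (W u) | u. u \<in> carrier (L2 M) \<and> L2_norm M u \<le> 1}"

definition atomless :: "'a measure \<Rightarrow> bool" where
  "atomless M \<longleftrightarrow> (\<forall>X\<in>sets M. measure M X > 0 \<longrightarrow>
     (\<exists>Y\<in>sets M. Y \<subseteq> X \<and> 0 < measure M Y \<and> measure M Y < measure M X))"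

text \<open>Sets rather than indexed families suffice: in a family with \<open>\<mu>(Y\<^sub>j \<inter> Y\<^sub>k) = 0\<close> for \<open>j \<noteq> k\<close>, a
  repeated member is null and contributes nothing to \<open>mu_M\<close>.\<close>

definition ae_partitions :: "'a measure \<Rightarrow> 'a set set set" where
  "ae_partitions M = {P. finite P \<and> P \<subseteq> sets M \<and> measure M (space M - \<Union>P) = 0 \<and>
     (\<forall>Y\<in>P. \<forall>Z\<in>P. Y \<noteq> Z \<longrightarrow> measure M (Y \<inter> Z) = 0)}"

definition mu_M ::
    "'a measure \<Rightarrow> 'a set set \<Rightarrow> (('a \<Rightarrow> complex) set \<Rightarrow> ('a \<Rightarrow> complex) set) \<Rightarrow> real" where
  "mu_M M P W = (\<Sum>Y\<in>P. measure M Y * (L2_opnorm M (W \<circ> L2_indicator_proj M Y))\<^sup>2)"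

definition mu_norm :: "'a measure \<Rightarrow> (('a \<Rightarrow> complex) set \<Rightarrow> ('a \<Rightarrow> complex) set) \<Rightarrow> real" where
  "mu_norm M W = (INF P\<in>ae_partitions M. sqrt (mu_M M P W))"

definition mu_dim :: "'a measure \<Rightarrow> ('a \<Rightarrow> complex) set set \<Rightarrow> real" where
  "mu_dim M H = (mu_norm M (L2_proj M H))\<^sup>2"


text \<open>\<open>VectorSpace.subspace\<close> includes the assumption that the ambient record is a vector space; for
  \<open>L2 M\<close> this holds for every measure \<open>M\<close>, so only the conditions on \<open>H\<close> remain in
  \<open>L2_subspace M H\<close>.\<close>

lemma sq_integrable_zero: "(\<lambda>x. 0) \<in> sq_integrable M"
  by (simp add: sq_integrable_def)

lemma sq_integrable_scale:
  assumes "f \<in> sq_integrable M" shows "(\<lambda>x. c * f x) \<in> sq_integrable M"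
  using assms by (auto simp: sq_integrable_def norm_mult power_mult_distrib)

lemma sq_integrable_add:
  assumes f: "f \<in> sq_integrable M" and g: "g \<in> sq_integrable M"
  shows "(\<lambda>x. f x + g x) \<in> sq_integrable M"
proof -
  have [measurable]: "f \<in> borel_measurable M" "g \<in> borel_measurable M"
    using f g by (auto simp: sq_integrable_def)
  have "integrable M (\<lambda>x. (cmod (f x + g x))\<^sup>2)"
  proof (rule Bochner_Integration.integrable_bound)
    show "integrable M (\<lambda>x. 2 * (cmod (f x))\<^sup>2 + 2 * (cmod (g x))\<^sup>2)"
      using f g by (auto simp: sq_integrable_def)
    have "(cmod (f x + g x))\<^sup>2 \<le> 2 * (cmod (f x))\<^sup>2 + 2 * (cmod (g x))\<^sup>2" for x
    proof -
      have "(cmod (f x + g x))\<^sup>2 \<le> (cmod (f x) + cmod (g x))\<^sup>2"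
        by (intro power_mono norm_triangle_ineq) auto
      also have "\<dots> \<le> 2 * (cmod (f x))\<^sup>2 + 2 * (cmod (g x))\<^sup>2"
        using sum_squares_bound[of "cmod (f x)" "cmod (g x)"]
        by (simp add: power2_sum)
      finally show ?thesis .
    qed
    then show "AE x in M. norm ((cmod (f x + g x))\<^sup>2) \<le> norm (2 * (cmod (f x))\<^sup>2 + 2 * (cmod (g x))\<^sup>2)"
      by (intro AE_I2) simp
  qed measurable
  then show ?thesis by (simp add: sq_integrable_def)
qed

lemma equiv_L2_rel: "equiv (sq_integrable M) (L2_rel M)"
  by (rule equivI) (auto simp: L2_rel_def refl_on_def intro!: symI transI elim: AE_mp)

lemma L2_class_eq_iff:
  assumes "f \<in> sq_integrable M" "g \<in> sq_integrable M"
  shows "L2_class M f = L2_class M g \<longleftrightarrow> (AE x in M. f x = g x)"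
  using eq_equiv_class_iff[OF equiv_L2_rel assms] assms by (simp add: L2_rel_def)

lemma L2_class_in_carrier: "f \<in> sq_integrable M \<Longrightarrow> L2_class M f \<in> carrier (L2 M)"
  by (simp add: L2_def quotientI)

lemma L2_rep_class:
  assumes "f \<in> sq_integrable M"
  shows "L2_rep (L2_class M f) \<in> sq_integrable M" "AE x in M. f x = L2_rep (L2_class M f) x"
proof -
  have "f \<in> L2_class M f" using assms by (simp add: L2_rel_def)
  then have "L2_rep (L2_class M f) \<in> L2_class M f"
    unfolding L2_rep_def by (rule someI[of "\<lambda>h. h \<in> L2_class M f"])
  then show "L2_rep (L2_class M f) \<in> sq_integrable M" "AE x in M. f x = L2_rep (L2_class M f) x"
    by (auto simp: L2_rel_def)
qed

lemma L2_cases: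
  assumes "u \<in> carrier (L2 M)"
  obtains f where "f \<in> sq_integrable M" "u = L2_class M f"
  using assms by (auto simp: L2_def elim: quotientE)

lemma L2_add_class:
  assumes "f \<in> sq_integrable M" "g \<in> sq_integrable M"
  shows "L2_class M f \<oplus>\<^bsub>L2 M\<^esub> L2_class M g = L2_class M (\<lambda>x. f x + g x)"
proof -
  have "AE x in M. L2_rep (L2_class M f) x + L2_rep (L2_class M g) x = f x + g x"
    using L2_rep_class(2)[OF assms(1)] L2_rep_class(2)[OF assms(2)] by eventually_elim simp
  then show ?thesis
    using assms by (simp add: L2_def L2_class_eq_iff sq_integrable_add L2_rep_class(1))
qed

lemma L2_smult_class:
  assumes "f \<in> sq_integrable M"
  shows "c \<odot>\<^bsub>L2 M\<^esub> L2_class M f = L2_class M (\<lambda>x. c * f x)"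
proof -
  have "AE x in M. c * L2_rep (L2_class M f) x = c * f x"
    using L2_rep_class(2)[OF assms(1)] by eventually_elim simp
  then show ?thesis
    using assms by (simp add: L2_def L2_class_eq_iff sq_integrable_scale L2_rep_class(1))
qed

lemma L2_zero: "\<zero>\<^bsub>L2 M\<^esub> = L2_class M (\<lambda>x. 0)"
  by (simp add: L2_def)

lemma vectorspace_L2: "vectorspace class_ring (L2 M)"
proof -
  note [simp] = L2_add_class L2_smult_class L2_zero sq_integrable_zero sq_integrable_add
    sq_integrable_scale L2_class_in_carrier
  have "abelian_group (L2 M)"
  proof (rule abelian_groupI)
    fix u assume "u \<in> carrier (L2 M)"
    then obtain f where f: "f \<in> sq_integrable M" "u = L2_class M f" by (rule L2_cases)
    have "L2_class M (\<lambda>x. (-1) * f x) \<oplus>\<^bsub>L2 M\<^esub> u = \<zero>\<^bsub>L2 M\<^esub>"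
      unfolding f(2) using L2_add_class[OF sq_integrable_scale[OF f(1), of "-1"] f(1)] by simp
    then show "\<exists>v\<in>carrier (L2 M). v \<oplus>\<^bsub>L2 M\<^esub> u = \<zero>\<^bsub>L2 M\<^esub>"
      using f sq_integrable_scale[OF f(1), of "-1"] L2_class_in_carrier by blast
  qed (auto elim!: L2_cases simp: ac_simps)
  then have "Module.module class_ring (L2 M)"
    by (intro moduleI class_cring.is_cring) (auto elim!: L2_cases simp: algebra_simps)
  then show ?thesis
    by (simp add: vectorspace_def class_field)
qed

end

theory Submission
  imports Defs
begin

text \<open>Let \<open>S\<close> be an orthonormal basis of a finite-dimensional \<open>H\<close>. By Cauchy--Schwarz
  \<open>\<parallel>\<pi>\<^sub>H \<pi>\<^sub>Y\<parallel>\<^sup>2 \<le> \<Sum>\<^sub>f \<parallel>\<pi>\<^sub>Y f\<parallel>\<^sup>2\<close> with \<open>f\<close> ranging over \<open>S\<close>, and for a partition these bounds add up to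
  \<open>card S\<close>. A partition into sets of measure at most \<open>d\<close> thus has \<open>mu_M \<le> d \<cdot> card S\<close>, and \<open>d\<close> may be
  taken arbitrarily small when the measure is atomless. If \<open>Y\<close> contains an atom \<open>x\<close>, testing \<open>\<pi>\<^sub>H \<pi>\<^sub>Y\<close> on
  the normalised indicator of \<open>x\<close> gives \<open>\<Sum>\<^sub>f \<parallel>\<pi>\<^sub>x f\<parallel>\<^sup>2 \<le> \<parallel>\<pi>\<^sub>H \<pi>\<^sub>Y\<parallel>\<^sup>2\<close>, so for the uniform
  measure the partition into atoms is optimal. If \<open>H\<close> is the range of \<open>\<pi>\<^sub>X\<close>, then \<open>\<pi>\<^sub>H \<pi>\<^sub>Y\<close> has
  norm 1 or 0 according to whether \<open>X \<inter> Y\<close> has positive measure, and the partition into \<open>X\<close> and its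
  complement is optimal.\<close>

section \<open>The inner product of classes\<close>

interpretation L2: vectorspace class_ring "L2 M" for M :: "'a measure"
  by (rule vectorspace_L2)

lemma sq_integrable_indicator_mult:
  assumes "f \<in> sq_integrable M" "X \<in> sets M"
  shows "(\<lambda>x. indicator X x * f x) \<in> sq_integrable M"
proof -
  have [measurable]: "f \<in> borel_measurable M" "X \<in> sets M"
    using assms by (auto simp: sq_integrable_def)
  have "integrable M (\<lambda>x. (cmod (indicator X x * f x))\<^sup>2)"
  proof (rule Bochner_Integration.integrable_bound)
    show "integrable M (\<lambda>x. (cmod (f x))\<^sup>2)"
      using assms by (simp add: sq_integrable_def)
    show "AE x in M. norm ((cmod (indicator X x * f x))\<^sup>2) \<le> norm ((cmod (f x))\<^sup>2)"
      by (auto simp: indicator_def)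
  qed measurable
  then show ?thesis by (simp add: sq_integrable_def)
qed

lemma integrable_mult_cnj:
  assumes "f \<in> sq_integrable M" "g \<in> sq_integrable M"
  shows "integrable M (\<lambda>x. f x * cnj (g x))"
proof (rule Bochner_Integration.integrable_bound)
  have [measurable]: "f \<in> borel_measurable M" "g \<in> borel_measurable M"
    using assms by (auto simp: sq_integrable_def)
  show "integrable M (\<lambda>x. (cmod (f x))\<^sup>2 + (cmod (g x))\<^sup>2)"
    using assms by (auto simp: sq_integrable_def)
  show "(\<lambda>x. f x * cnj (g x)) \<in> borel_measurable M"
    by (intro borel_measurable_times borel_measurable_continuous_on[OF continuous_on_cnj[OF continuous_on_id]])
      measurable
  have "cmod (f x) * cmod (g x) \<le> (cmod (f x))\<^sup>2 + (cmod (g x))\<^sup>2" for x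
    using sum_squares_bound[of "cmod (f x)" "cmod (g x)"]
      mult_nonneg_nonneg[OF norm_ge_zero norm_ge_zero, of "f x" "g x"] by linarith
  then show "AE x in M. norm (f x * cnj (g x)) \<le> norm ((cmod (f x))\<^sup>2 + (cmod (g x))\<^sup>2)"
    by (intro AE_I2) (simp add: norm_mult)
qed

text \<open>Representatives of a class agree almost everywhere, so the one picked by
  \<open>L2_rep\<close> may be replaced under the integral. With \<open>L2_norm_class_sq\<close>
  this lets later computations work with an arbitrary representative.\<close>

lemma L2_inner_class:
  assumes "f \<in> sq_integrable M" "g \<in> sq_integrable M"
  shows "L2_inner M (L2_class M f) (L2_class M g) = (\<integral>x. f x * cnj (g x) \<partial>M)"
proof -
  have m: "h \<in> sq_integrable M \<Longrightarrow> k \<in> sq_integrable M \<Longrightarrow> (\<lambda>x. h x * cnj (k x)) \<in> borel_measurable M" for h k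
    by (rule borel_measurable_integrable[OF integrable_mult_cnj])
  show ?thesis
    unfolding L2_inner_def
    using L2_rep_class(2)[OF assms(1)] L2_rep_class(2)[OF assms(2)]
    by (intro integral_cong_AE m L2_rep_class(1) assms) auto
qed

lemma L2_norm_nonneg: "0 \<le> L2_norm M u"
  by (simp add: L2_norm_def)

lemma L2_norm_class_sq:
  assumes "f \<in> sq_integrable M"
  shows "(L2_norm M (L2_class M f))\<^sup>2 = (\<integral>x. (cmod (f x))\<^sup>2 \<partial>M)"
proof -
  have m: "h \<in> sq_integrable M \<Longrightarrow> (\<lambda>x. (cmod (h x))\<^sup>2) \<in> borel_measurable M" for h
    by (auto simp: sq_integrable_def)
  have "(\<integral>x. (cmod (L2_rep (L2_class M f) x))\<^sup>2 \<partial>M) = (\<integral>x. (cmod (f x))\<^sup>2 \<partial>M)"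
    using L2_rep_class(2)[OF assms]
    by (intro integral_cong_AE m L2_rep_class(1) assms) auto
  then show ?thesis by (simp add: L2_norm_def)
qed

lemma L2_inner_self:
  assumes "u \<in> carrier (L2 M)"
  shows "L2_inner M u u = of_real ((L2_norm M u)\<^sup>2)"
proof -
  obtain f where f: "f \<in> sq_integrable M" "u = L2_class M f" by (rule L2_cases[OF assms])
  have "L2_inner M u u = (\<integral>x. complex_of_real ((cmod (f x))\<^sup>2) \<partial>M)"
    by (simp only: f(2) L2_inner_class[OF f(1) f(1)] complex_norm_square)
  then show ?thesis
    by (simp only: f(2) L2_norm_class_sq[OF f(1)] integral_complex_of_real)
qed

lemma L2_inner_cnj: "L2_inner M v u = cnj (L2_inner M u v)"
proof -
  have "(\<lambda>x. L2_rep v x * cnj (L2_rep u x)) = (\<lambda>x. cnj (L2_rep u x * cnj (L2_rep v x)))"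
    by (simp add: mult.commute)
  then show ?thesis
    by (simp only: L2_inner_def Bochner_Integration.integral_cnj)
qed

lemma L2_inner_add_left:
  assumes "u \<in> carrier (L2 M)" "v \<in> carrier (L2 M)" "w \<in> carrier (L2 M)"
  shows "L2_inner M (u \<oplus>\<^bsub>L2 M\<^esub> v) w = L2_inner M u w + L2_inner M v w"
proof -
  obtain f g h where "f \<in> sq_integrable M" "g \<in> sq_integrable M" "h \<in> sq_integrable M"
    "u = L2_class M f" "v = L2_class M g" "w = L2_class M h"
    using assms by (metis L2_cases)
  then show ?thesis
    by (simp add: L2_add_class L2_inner_class sq_integrable_add distrib_right integrable_mult_cnj)
qed

lemma L2_inner_smult_left:
  assumes "u \<in> carrier (L2 M)" "w \<in> carrier (L2 M)"
  shows "L2_inner M (c \<odot>\<^bsub>L2 M\<^esub> u) w = c * L2_inner M u w"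
proof -
  obtain f h where "f \<in> sq_integrable M" "h \<in> sq_integrable M"
    "u = L2_class M f" "w = L2_class M h"
    using assms by (metis L2_cases)
  then show ?thesis
    by (simp add: L2_smult_class L2_inner_class sq_integrable_scale mult.assoc)
qed

text \<open>Reduces subtraction in the record to addition and scaling, for which linearity of the
  inner product is available.\<close>

lemma L2_minus_eq:
  assumes "u \<in> carrier (L2 M)" "v \<in> carrier (L2 M)"
  shows "u \<ominus>\<^bsub>L2 M\<^esub> v = u \<oplus>\<^bsub>L2 M\<^esub> ((-1) \<odot>\<^bsub>L2 M\<^esub> v)"
proof -
  have "\<ominus>\<^bsub>L2 M\<^esub> v = (-1) \<odot>\<^bsub>L2 M\<^esub> v"
    using L2.smult_l_minus[of 1 v] L2.smult_one[of v] assms by (simp add: class_ring_simps)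
  then show ?thesis by (simp add: a_minus_def)
qed

lemma L2_smult_closed: "u \<in> carrier (L2 M) \<Longrightarrow> c \<odot>\<^bsub>L2 M\<^esub> u \<in> carrier (L2 M)"
  by (rule L2.smult_closed) simp_all

lemma L2_inner_minus_left:
  assumes "u \<in> carrier (L2 M)" "v \<in> carrier (L2 M)" "w \<in> carrier (L2 M)"
  shows "L2_inner M (u \<ominus>\<^bsub>L2 M\<^esub> v) w = L2_inner M u w - L2_inner M v w"
  using assms
  by (simp add: L2_minus_eq L2_inner_add_left L2_inner_smult_left L2_smult_closed)

lemma L2_inner_minus_right:
  assumes "u \<in> carrier (L2 M)" "v \<in> carrier (L2 M)" "w \<in> carrier (L2 M)"
  shows "L2_inner M w (u \<ominus>\<^bsub>L2 M\<^esub> v) = L2_inner M w u - L2_inner M w v"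
  using assms L2_inner_cnj[of M w "u \<ominus>\<^bsub>L2 M\<^esub> v"] L2_inner_cnj[of M w u] L2_inner_cnj[of M w v]
  by (simp add: L2_inner_minus_left)

lemma L2_inner_zero_left: "w \<in> carrier (L2 M) \<Longrightarrow> L2_inner M \<zero>\<^bsub>L2 M\<^esub> w = 0"
  using L2_inner_add_left[of "\<zero>\<^bsub>L2 M\<^esub>" M "\<zero>\<^bsub>L2 M\<^esub>" w] by simp

lemma L2_norm_zero: "L2_norm M \<zero>\<^bsub>L2 M\<^esub> = 0"
  using L2_inner_self[of "\<zero>\<^bsub>L2 M\<^esub>" M] L2_inner_zero_left[of "\<zero>\<^bsub>L2 M\<^esub>" M] by simp

lemma L2_norm_eq_zero:
  assumes "u \<in> carrier (L2 M)" "L2_norm M u = 0"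
  shows "u = \<zero>\<^bsub>L2 M\<^esub>"
proof -
  obtain f where f: "f \<in> sq_integrable M" "u = L2_class M f" by (rule L2_cases[OF assms(1)])
  have "(\<integral>x. (cmod (f x))\<^sup>2 \<partial>M) = 0"
    using assms(2) L2_norm_class_sq[OF f(1)] f(2) by simp
  moreover have "integrable M (\<lambda>x. (cmod (f x))\<^sup>2)"
    using f(1) by (simp add: sq_integrable_def)
  ultimately have "AE x in M. f x = 0"
    by (subst (asm) integral_nonneg_eq_0_iff_AE) auto
  then show ?thesis
    unfolding f(2) L2_zero using f(1) by (simp add: L2_class_eq_iff sq_integrable_zero)
qed

lemma L2_norm_smult:
  assumes "u \<in> carrier (L2 M)"
  shows "L2_norm M (c \<odot>\<^bsub>L2 M\<^esub> u) = cmod c * L2_norm M u"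
proof -
  obtain f where f: "f \<in> sq_integrable M" "u = L2_class M f" by (rule L2_cases[OF assms])
  have "(L2_norm M (c \<odot>\<^bsub>L2 M\<^esub> u))\<^sup>2 = (cmod c * L2_norm M u)\<^sup>2"
    using f by (simp add: L2_smult_class L2_norm_class_sq sq_integrable_scale norm_mult power_mult_distrib)
  then show ?thesis
    by (rule power2_eq_imp_eq) (simp_all add: L2_norm_nonneg)
qed

section \<open>Multiplication by an indicator function\<close>

lemma L2_indicator_proj_class:
  assumes "f \<in> sq_integrable M" "X \<in> sets M"
  shows "L2_indicator_proj M X (L2_class M f) = L2_class M (\<lambda>x. indicator X x * f x)"
proof -
  have "AE x in M. indicator X x * L2_rep (L2_class M f) x = indicator X x * f x"
    using L2_rep_class(2)[OF assms(1)] by eventually_elim simp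
  then show ?thesis
    using assms
    by (simp add: L2_indicator_proj_def L2_class_eq_iff sq_integrable_indicator_mult L2_rep_class(1))
qed

lemma L2_indicator_proj_closed:
  assumes "u \<in> carrier (L2 M)" "X \<in> sets M"
  shows "L2_indicator_proj M X u \<in> carrier (L2 M)"
  using assms
  by (auto elim!: L2_cases simp: L2_indicator_proj_class sq_integrable_indicator_mult L2_class_in_carrier)

text \<open>Indicators are real-valued, hence equal to their conjugates: multiplication by one is
  self-adjoint.\<close>

lemma L2_inner_indicator_proj:
  assumes "u \<in> carrier (L2 M)" "v \<in> carrier (L2 M)" "X \<in> sets M"
  shows "L2_inner M (L2_indicator_proj M X u) v = L2_inner M u (L2_indicator_proj M X v)"
proof -
  obtain f g where "f \<in> sq_integrable M" "g \<in> sq_integrable M"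
    "u = L2_class M f" "v = L2_class M g"
    using assms by (metis L2_cases)
  moreover have "cnj (indicator X x) = indicator X x" for x by (simp add: indicator_def)
  ultimately show ?thesis
    using assms(3)
    by (simp add: L2_indicator_proj_class L2_inner_class sq_integrable_indicator_mult)
      (simp add: ac_simps)
qed

lemma L2_indicator_proj_Int:
  assumes "u \<in> carrier (L2 M)" "X \<in> sets M" "Y \<in> sets M"
  shows "L2_indicator_proj M X (L2_indicator_proj M Y u) = L2_indicator_proj M (X \<inter> Y) u"
  using assms
  by (auto elim!: L2_cases
      simp: L2_indicator_proj_class sq_integrable_indicator_mult indicator_inter_arith mult.assoc)

lemma L2_indicator_proj_null:
  assumes "u \<in> carrier (L2 M)" "X \<in> null_sets M"
  shows "L2_indicator_proj M X u = \<zero>\<^bsub>L2 M\<^esub>"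
proof -
  obtain f where f: "f \<in> sq_integrable M" "u = L2_class M f" by (rule L2_cases[OF assms(1)])
  have "AE x in M. indicator X x * f x = 0"
    using AE_not_in[OF assms(2)] by eventually_elim simp
  then show ?thesis
    using f assms(2)
    by (simp add: L2_indicator_proj_class L2_zero L2_class_eq_iff sq_integrable_zero
        sq_integrable_indicator_mult null_setsD2)
qed

lemma L2_norm_indicator_proj_sq:
  assumes "f \<in> sq_integrable M" "X \<in> sets M"
  shows "(L2_norm M (L2_indicator_proj M X (L2_class M f)))\<^sup>2 = (\<integral>x. indicator X x * (cmod (f x))\<^sup>2 \<partial>M)"
proof -
  have "(cmod (indicator X x * f x))\<^sup>2 = indicator X x * (cmod (f x))\<^sup>2" for x
    by (simp add: indicator_def)
  then show ?thesis
    using assms by (simp add: L2_indicator_proj_class L2_norm_class_sq sq_integrable_indicator_mult)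
qed

lemma L2_norm_indicator_proj_le:
  assumes "u \<in> carrier (L2 M)" "X \<in> sets M"
  shows "L2_norm M (L2_indicator_proj M X u) \<le> L2_norm M u"
proof -
  obtain f where f: "f \<in> sq_integrable M" "u = L2_class M f" by (rule L2_cases[OF assms(1)])
  have i: "integrable M (\<lambda>x. (cmod (f x))\<^sup>2)" using f(1) by (simp add: sq_integrable_def)
  have "(\<integral>x. indicator X x * (cmod (f x))\<^sup>2 \<partial>M) \<le> (\<integral>x. (cmod (f x))\<^sup>2 \<partial>M)"
    using integrable_real_mult_indicator[OF assms(2) i] i
    by (intro integral_mono) (simp_all add: mult.commute indicator_def)
  then have "(L2_norm M (L2_indicator_proj M X u))\<^sup>2 \<le> (L2_norm M u)\<^sup>2"
    using f assms(2) by (simp add: L2_norm_indicator_proj_sq L2_norm_class_sq)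
  then show ?thesis
    by (rule power2_le_imp_le) (rule L2_norm_nonneg)
qed

text \<open>Pythagoras for a partition: the indicators of its members add up to 1 at every point of
  the space, so the squared norm splits into integrals over the pieces.\<close>

lemma sum_L2_norm_indicator_proj:
  assumes u: "u \<in> carrier (L2 M)"
    and P: "finite P" "P \<subseteq> sets M" "disjoint P" "\<Union>P = space M"
  shows "(\<Sum>Y\<in>P. (L2_norm M (L2_indicator_proj M Y u))\<^sup>2) = (L2_norm M u)\<^sup>2"
proof -
  obtain f where f: "f \<in> sq_integrable M" "u = L2_class M f" by (rule L2_cases[OF u])
  have i: "integrable M (\<lambda>x. indicator Y x * (cmod (f x))\<^sup>2)" if "Y \<in> P" for Y
    using that P(2) f(1) integrable_real_mult_indicator[of Y M "\<lambda>x. (cmod (f x))\<^sup>2"]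
    by (auto simp: sq_integrable_def mult.commute)
  have "(\<Sum>Y\<in>P. (L2_norm M (L2_indicator_proj M Y u))\<^sup>2)
      = (\<Sum>Y\<in>P. \<integral>x. indicator Y x * (cmod (f x))\<^sup>2 \<partial>M)"
    using f P(2) by (intro sum.cong) (auto simp: L2_norm_indicator_proj_sq)
  also have "\<dots> = (\<integral>x. (\<Sum>Y\<in>P. indicator Y x * (cmod (f x))\<^sup>2) \<partial>M)"
    using i by (rule Bochner_Integration.integral_sum[symmetric])
  also have "\<dots> = (\<integral>x. (cmod (f x))\<^sup>2 \<partial>M)"
  proof (rule Bochner_Integration.integral_cong[OF refl])
    fix x assume "x \<in> space M"
    have "(\<Sum>Y\<in>P. indicator Y x) = (indicator (\<Union>P) x :: real)"
      using P(1,3) by (subst indicator_UN_disjoint[symmetric, of P "\<lambda>Y. Y", simplified])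
        (auto simp: disjoint_family_on_def disjoint_def)
    then show "(\<Sum>Y\<in>P. indicator Y x * (cmod (f x))\<^sup>2) = (cmod (f x))\<^sup>2"
      using \<open>x \<in> space M\<close> P(4) by (simp flip: sum_distrib_right)
  qed
  finally show ?thesis using f by (simp add: L2_norm_class_sq)
qed

section \<open>Orthonormal sets and orthogonal projections\<close>

text \<open>Finiteness is built in because \<open>lincomb\<close> is a sum that takes the default
  value zero on infinite sets.\<close>

definition orthonormal :: "'a measure \<Rightarrow> ('a \<Rightarrow> complex) set set \<Rightarrow> bool" where
  "orthonormal M S \<longleftrightarrow> finite S \<and> S \<subseteq> carrier (L2 M) \<and>
     (\<forall>u\<in>S. \<forall>v\<in>S. L2_inner M u v = (if u = v then 1 else 0))"

lemma orthonormal_empty: "orthonormal M {}"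
  by (simp add: orthonormal_def)

lemma orthonormalD:
  assumes "orthonormal M S"
  shows "finite S" "S \<subseteq> carrier (L2 M)"
    "\<And>u v. u \<in> S \<Longrightarrow> v \<in> S \<Longrightarrow> L2_inner M u v = (if u = v then 1 else 0)"
  using assms by (auto simp: orthonormal_def)

lemma L2_lincomb_closed:
  "S \<subseteq> carrier (L2 M) \<Longrightarrow> L2.lincomb M a S \<in> carrier (L2 M)"
  by (rule L2.lincomb_closed) auto

lemma L2_inner_lincomb_left:
  assumes "finite S" "S \<subseteq> carrier (L2 M)" "w \<in> carrier (L2 M)"
  shows "L2_inner M (L2.lincomb M a S) w = (\<Sum>u\<in>S. a u * L2_inner M u w)"
  using assms(1,2)
proof (induction S rule: finite_induct)
  case empty
  then show ?case
    using assms(3) by (simp add: L2.lincomb_def L2_inner_zero_left)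
next
  case (insert x F)
  have "L2.lincomb M a (insert x F) = (a x \<odot>\<^bsub>L2 M\<^esub> x) \<oplus>\<^bsub>L2 M\<^esub> L2.lincomb M a F"
    using L2.lincomb_insert[where S = F and a = a and v = x and M = M] insert by simp
  then show ?case
    using insert assms(3)
    by (simp add: L2_inner_add_left L2_inner_smult_left L2_smult_closed L2_lincomb_closed)
qed

lemma L2_inner_lincomb_orthonormal:
  assumes S: "orthonormal M S" and v: "v \<in> S"
  shows "L2_inner M (L2.lincomb M a S) v = a v"
proof -
  have "L2_inner M (L2.lincomb M a S) v = (\<Sum>u\<in>S. a u * L2_inner M u v)"
    using orthonormalD[OF S] v by (intro L2_inner_lincomb_left) auto
  also have "\<dots> = (\<Sum>u\<in>S. if u = v then a v else 0)"
    using orthonormalD(3)[OF S _ v] by (intro sum.cong) auto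
  finally show ?thesis
    using v orthonormalD(1)[OF S] by simp
qed

text \<open>Parseval's identity: expand the left argument of the inner product of the combination
  with itself. Each remaining product is the conjugate of a coefficient.\<close>

lemma L2_norm_lincomb_orthonormal:
  assumes S: "orthonormal M S"
  shows "(L2_norm M (L2.lincomb M a S))\<^sup>2 = (\<Sum>u\<in>S. (cmod (a u))\<^sup>2)"
proof -
  let ?p = "L2.lincomb M a S"
  note S' = orthonormalD[OF S]
  have p: "?p \<in> carrier (L2 M)" by (rule L2_lincomb_closed[OF S'(2)])
  have "complex_of_real ((L2_norm M ?p)\<^sup>2) = (\<Sum>u\<in>S. a u * L2_inner M u ?p)"
    unfolding L2_inner_self[OF p, symmetric] by (rule L2_inner_lincomb_left[OF S'(1,2) p])
  also have "\<dots> = (\<Sum>u\<in>S. a u * cnj (a u))"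
    using L2_inner_lincomb_orthonormal[OF S]
    by (intro sum.cong refl) (simp add: L2_inner_cnj[of M _ ?p])
  also have "\<dots> = complex_of_real (\<Sum>u\<in>S. (cmod (a u))\<^sup>2)"
    by (simp only: of_real_sum complex_norm_square)
  finally show ?thesis by (simp only: of_real_eq_iff)
qed

text \<open>The coefficients \<open>L2_inner M u v\<close> are chosen to cancel the inner product of
  \<open>u\<close> with each \<open>v\<close> in \<open>S\<close>; linearity extends the
  orthogonality to the span.\<close>

lemma L2_residual_orthogonal:
  assumes S: "orthonormal M S" and u: "u \<in> carrier (L2 M)" and w: "w \<in> L2.span M S"
  shows "L2_inner M (u \<ominus>\<^bsub>L2 M\<^esub> L2.lincomb M (L2_inner M u) S) w = 0"
proof -
  note S' = orthonormalD[OF S]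
  let ?p = "L2.lincomb M (L2_inner M u) S"
  have p: "?p \<in> carrier (L2 M)" by (rule L2_lincomb_closed[OF S'(2)])
  have r: "u \<ominus>\<^bsub>L2 M\<^esub> ?p \<in> carrier (L2 M)" using u p by simp
  have o: "L2_inner M v (u \<ominus>\<^bsub>L2 M\<^esub> ?p) = 0" if "v \<in> S" for v
  proof -
    have "v \<in> carrier (L2 M)" using that S'(2) by blast
    then have "L2_inner M (u \<ominus>\<^bsub>L2 M\<^esub> ?p) v = 0"
      using L2_inner_lincomb_orthonormal[OF S that] by (simp add: L2_inner_minus_left[OF u p])
    then show ?thesis by (subst L2_inner_cnj) simp
  qed
  obtain a where a: "w = L2.lincomb M a S"
    using w L2.finite_span[OF S'(1,2)] by auto
  have "L2_inner M w (u \<ominus>\<^bsub>L2 M\<^esub> ?p) = 0"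
    unfolding a using L2_inner_lincomb_left[OF S'(1,2) r] o by simp
  then show ?thesis by (subst L2_inner_cnj) simp
qed

text \<open>With \<open>p\<close> the expansion of \<open>u\<close> along \<open>S\<close> and
  \<open>r\<close> the residual, Pythagoras gives that the squared norm of \<open>u\<close> is that
  of \<open>p\<close> plus that of \<open>r\<close>. Parseval evaluates the former.\<close>

lemma L2_Bessel:
  assumes S: "orthonormal M S" and u: "u \<in> carrier (L2 M)"
  shows "(\<Sum>v\<in>S. (cmod (L2_inner M u v))\<^sup>2) \<le> (L2_norm M u)\<^sup>2"
proof -
  note S' = orthonormalD[OF S]
  let ?p = "L2.lincomb M (L2_inner M u) S"
  let ?r = "u \<ominus>\<^bsub>L2 M\<^esub> ?p"
  have p: "?p \<in> carrier (L2 M)" by (rule L2_lincomb_closed[OF S'(2)])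
  have r: "?r \<in> carrier (L2 M)" using u p by simp
  have pS: "?p \<in> L2.span M S"
    using L2.finite_span[OF S'(1,2)] by auto
  have rp: "L2_inner M ?r ?p = 0"
    by (rule L2_residual_orthogonal[OF S u pS])
  \<comment> \<open>The inner product of \<open>p\<close> with itself is real, so both mixed
    products of \<open>u\<close> and \<open>p\<close> equal it and only a difference of squared
    norms survives.\<close>
  have "L2_inner M u ?p = L2_inner M ?p ?p"
    using rp L2_inner_minus_left[OF u p p] by simp
  moreover have "L2_inner M ?p u = cnj (L2_inner M u ?p)"
    by (rule L2_inner_cnj)
  ultimately have "L2_inner M ?r ?r = L2_inner M u u - L2_inner M ?p ?p"
    using rp u p r by (simp add: L2_inner_minus_right) (simp add: L2_inner_minus_left L2_inner_self)
  then have "complex_of_real ((L2_norm M ?r)\<^sup>2) = complex_of_real ((L2_norm M u)\<^sup>2 - (L2_norm M ?p)\<^sup>2)"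
    using u p r by (simp only: L2_inner_self of_real_diff)
  then have "(L2_norm M ?r)\<^sup>2 = (L2_norm M u)\<^sup>2 - (L2_norm M ?p)\<^sup>2"
    by (simp only: of_real_eq_iff)
  then show ?thesis
    using L2_norm_lincomb_orthonormal[OF S, of "L2_inner M u"] zero_le_power2[of "L2_norm M ?r"]
    by linarith
qed

lemma orthonormal_normalize:
  assumes u: "u \<in> carrier (L2 M)" "u \<noteq> \<zero>\<^bsub>L2 M\<^esub>"
  defines "e \<equiv> complex_of_real (1 / L2_norm M u) \<odot>\<^bsub>L2 M\<^esub> u"
  shows "e \<in> carrier (L2 M)" "L2_inner M e e = 1"
proof -
  have n: "L2_norm M u > 0"
    using L2_norm_eq_zero[of u M] L2_norm_nonneg[of M u] u by fastforce
  show c: "e \<in> carrier (L2 M)" unfolding e_def by (rule L2_smult_closed[OF u(1)])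
  have "L2_norm M e = 1"
    unfolding e_def L2_norm_smult[OF u(1)] using n by (simp add: norm_divide)
  then show "L2_inner M e e = 1" by (simp add: L2_inner_self[OF c])
qed

text \<open>Bessel's inequality for the one-element orthonormal set obtained by normalising
  \<open>v\<close>.\<close>

lemma L2_Cauchy_Schwarz:
  assumes u: "u \<in> carrier (L2 M)" and v: "v \<in> carrier (L2 M)"
  shows "cmod (L2_inner M u v) \<le> L2_norm M u * L2_norm M v"
proof (cases "v = \<zero>\<^bsub>L2 M\<^esub>")
  case True
  then show ?thesis
    using L2_inner_zero_left[OF u] L2_inner_cnj[of M u "\<zero>\<^bsub>L2 M\<^esub>"] by (simp add: L2_norm_zero)
next
  case False
  let ?e = "complex_of_real (1 / L2_norm M v) \<odot>\<^bsub>L2 M\<^esub> v"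
  have n: "L2_norm M v > 0"
    using L2_norm_eq_zero[of v M] L2_norm_nonneg[of M v] v False by fastforce
  have "orthonormal M {?e}"
    using orthonormal_normalize[OF v False] by (simp add: orthonormal_def)
  from L2_Bessel[OF this u] have "(cmod (L2_inner M u ?e))\<^sup>2 \<le> (L2_norm M u)\<^sup>2"
    by simp
  then have "cmod (L2_inner M u ?e) \<le> L2_norm M u"
    by (rule power2_le_imp_le) (rule L2_norm_nonneg)
  moreover have "cmod (L2_inner M u ?e) = cmod (L2_inner M u v) / L2_norm M v"
    using n u v
    by (simp add: L2_inner_cnj[of M u] L2_inner_smult_left norm_mult norm_divide)
  ultimately show ?thesis
    using n by (simp only: pos_divide_le_eq)
qed

section \<open>Orthogonal projection onto a subspace\<close>

lemma L2_subspaceD: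
  assumes "L2_subspace M H"
  shows "LinearCombinations.submodule class_ring H (L2 M)" "H \<subseteq> carrier (L2 M)"
    "\<And>c u. u \<in> H \<Longrightarrow> c \<odot>\<^bsub>L2 M\<^esub> u \<in> H"
    "\<And>u v. u \<in> H \<Longrightarrow> v \<in> H \<Longrightarrow> u \<ominus>\<^bsub>L2 M\<^esub> v \<in> H"
proof -
  show s: "LinearCombinations.submodule class_ring H (L2 M)"
    using assms by (simp add: VectorSpace.subspace_def)
  interpret H: LinearCombinations.submodule class_ring H "L2 M" by (rule s)
  show H: "H \<subseteq> carrier (L2 M)" by (rule H.subset)
  show c: "c \<odot>\<^bsub>L2 M\<^esub> u \<in> H" if "u \<in> H" for c u
    using that by (intro H.smult_closed) simp_all
  show "u \<ominus>\<^bsub>L2 M\<^esub> v \<in> H" if "u \<in> H" "v \<in> H" for u v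
    using that H c by (auto simp: L2_minus_eq subset_iff)
qed

text \<open>Resolves the definite description in \<open>L2_proj\<close>. The difference of two
  candidates lies in \<open>H\<close> and is orthogonal to all of \<open>H\<close>, in particular to
  itself, so it vanishes.\<close>

lemma L2_proj_eqI:
  assumes H: "L2_subspace M H" and u: "u \<in> carrier (L2 M)" and v: "v \<in> H"
    and o: "\<And>w. w \<in> H \<Longrightarrow> L2_inner M (u \<ominus>\<^bsub>L2 M\<^esub> v) w = 0"
  shows "L2_proj M H u = v"
  unfolding L2_proj_def
proof (rule the_equality)
  show "v \<in> H \<and> (\<forall>w\<in>H. L2_inner M (u \<ominus>\<^bsub>L2 M\<^esub> v) w = 0)" using v o by blast
next
  fix v' assume v': "v' \<in> H \<and> (\<forall>w\<in>H. L2_inner M (u \<ominus>\<^bsub>L2 M\<^esub> v') w = 0)"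
  let ?d = "v' \<ominus>\<^bsub>L2 M\<^esub> v"
  note HD = L2_subspaceD[OF H]
  have d: "?d \<in> H" using HD(4) v v' by blast
  have c: "v \<in> carrier (L2 M)" "v' \<in> carrier (L2 M)" "?d \<in> carrier (L2 M)"
    using v v' d HD(2) by auto
  have "L2_inner M ?d ?d = 0"
    using o[OF d] v' d L2_inner_minus_left[OF c(2,1,3)] L2_inner_minus_left[OF u c(1,3)]
      L2_inner_minus_left[OF u c(2,3)] by force
  then have "?d = \<zero>\<^bsub>L2 M\<^esub>"
    using c(3) by (intro L2_norm_eq_zero) (simp_all add: L2_inner_self)
  then show "v' = v" using c by simp
qed

lemma L2_proj_span_orthonormal:
  assumes H: "L2_subspace M H" and S: "orthonormal M S" "L2.span M S = H"
    and u: "u \<in> carrier (L2 M)"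
  shows "L2_proj M H u = L2.lincomb M (L2_inner M u) S"
proof (rule L2_proj_eqI[OF H u])
  show "L2.lincomb M (L2_inner M u) S \<in> H"
    using L2.finite_span[OF orthonormalD(1,2)[OF S(1)]] S(2) by auto
qed (use L2_residual_orthogonal[OF S(1) u] S(2) in auto)

lemma L2_norm_proj_sq:
  assumes "L2_subspace M H" "orthonormal M S" "L2.span M S = H" "u \<in> carrier (L2 M)"
  shows "(L2_norm M (L2_proj M H u))\<^sup>2 = (\<Sum>v\<in>S. (cmod (L2_inner M u v))\<^sup>2)"
  unfolding L2_proj_span_orthonormal[OF assms] by (rule L2_norm_lincomb_orthonormal[OF assms(2)])

section \<open>Orthonormal bases and dimension\<close>

lemma orthonormal_lin_indpt:
  assumes S: "orthonormal M S"
  shows "\<not> L2.lin_dep M S"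
proof
  assume "L2.lin_dep M S"
  from L2.finite_lin_dep[OF orthonormalD(1)[OF S] this orthonormalD(2)[OF S]]
  obtain a v where a: "L2.lincomb M a S = \<zero>\<^bsub>L2 M\<^esub>" "v \<in> S" "a v \<noteq> 0" by auto
  then show False
    using L2_inner_lincomb_orthonormal[OF S a(2), of a] L2_inner_zero_left[of v M]
      orthonormalD(2)[OF S] by auto
qed

text \<open>One Gram-Schmidt step: take a vector of \<open>H\<close> outside the span, subtract its
  expansion along \<open>S\<close> and normalise the residual.\<close>

lemma orthonormal_extend:
  assumes H: "L2_subspace M H" and S: "orthonormal M S" "S \<subseteq> H" "L2.span M S \<noteq> H"
  obtains e where "e \<in> H" "e \<notin> S" "orthonormal M (insert e S)"
proof -
  note HD = L2_subspaceD[OF H] and S' = orthonormalD[OF S(1)]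
  have "L2.span M S \<subseteq> H" by (rule L2.span_is_subset[OF S(2) HD(1)])
  then obtain u where u: "u \<in> H" "u \<notin> L2.span M S" using S(3) by blast
  let ?p = "L2.lincomb M (L2_inner M u) S"
  let ?r = "u \<ominus>\<^bsub>L2 M\<^esub> ?p"
  have uc: "u \<in> carrier (L2 M)" using u HD(2) by blast
  have pS: "?p \<in> L2.span M S" using L2.finite_span[OF S'(1,2)] by auto
  then have p: "?p \<in> H" using \<open>L2.span M S \<subseteq> H\<close> by blast
  have r: "?r \<in> H" by (rule HD(4)[OF u(1) p])
  then have rc: "?r \<in> carrier (L2 M)" using HD(2) by blast
  \<comment> \<open>A zero residual would make \<open>u\<close> equal to its expansion and put it
    into the span.\<close>
  have rz: "?r \<noteq> \<zero>\<^bsub>L2 M\<^esub>"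
    using u(2) pS uc p HD(2) by auto
  let ?e = "complex_of_real (1 / L2_norm M ?r) \<odot>\<^bsub>L2 M\<^esub> ?r"
  note e = orthonormal_normalize[OF rc rz]
  have o: "L2_inner M ?e v = 0" if "v \<in> S" for v
  proof -
    have "v \<in> L2.span M S" "v \<in> carrier (L2 M)"
      using that S'(2) L2.in_own_span[OF S'(2)] by auto
    then show ?thesis
      using L2_residual_orthogonal[OF S(1) uc] by (simp add: L2_inner_smult_left[OF rc])
  qed
  have o': "L2_inner M v ?e = 0" if "v \<in> S" for v
    using o[OF that] by (subst L2_inner_cnj) simp
  \<comment> \<open>A member of \<open>S\<close> would be orthogonal to \<open>e\<close>, but
    \<open>e\<close> has inner product 1 with itself.\<close>
  have ne: "?e \<notin> S" using o[of ?e] e(2) by auto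
  show thesis
  proof
    show "?e \<in> H" by (rule HD(3)[OF r])
    show "?e \<notin> S" by (rule ne)
    show "orthonormal M (insert ?e S)"
      unfolding orthonormal_def
    proof (intro conjI ballI)
      fix x y assume "x \<in> insert ?e S" "y \<in> insert ?e S"
      then show "L2_inner M x y = (if x = y then 1 else 0)"
        using o o' e(2) ne S'(3) by (elim insertE) auto
    qed (use S' e in auto)
  qed
qed

text \<open>An orthonormal subset of largest cardinality spans, as it could otherwise be extended.
  The bound is left abstract because it has two sources: the dimension of \<open>H\<close> when that
  is finite, and the number of points of a finite uniform space.\<close>

lemma orthonormal_basis_exists:
  assumes H: "L2_subspace M H"
    and bound: "\<And>S. orthonormal M S \<Longrightarrow> S \<subseteq> H \<Longrightarrow> card S \<le> n"
  obtains S where "orthonormal M S" "L2.span M S = H"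
proof -
  have "\<exists>S. (orthonormal M S \<and> S \<subseteq> H) \<and> (\<forall>T. orthonormal M T \<and> T \<subseteq> H \<longrightarrow> card T \<le> card S)"
  proof (rule ex_has_greatest_nat)
    show "orthonormal M {} \<and> {} \<subseteq> H" by (simp add: orthonormal_empty)
    show "\<forall>T. orthonormal M T \<and> T \<subseteq> H \<longrightarrow> card T < Suc n" using bound by (simp add: less_Suc_eq_le)
  qed
  then obtain S where S: "orthonormal M S" "S \<subseteq> H"
    and max: "\<And>T. orthonormal M T \<Longrightarrow> T \<subseteq> H \<Longrightarrow> card T \<le> card S"
    by blast
  have "L2.span M S = H"
  proof (rule ccontr)
    assume "L2.span M S \<noteq> H"
    then obtain e where e: "e \<in> H" "e \<notin> S" "orthonormal M (insert e S)"
      by (rule orthonormal_extend[OF H S(1,2)])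
    have "card (insert e S) = Suc (card S)"
      using e(2) orthonormalD(1)[OF S(1)] by simp
    then show False using max[OF e(3)] e(1) S(2) by simp
  qed
  then show thesis using that S(1) by blast
qed

text \<open>The dimension refers to the record with carrier \<open>H\<close>, whereas span and
  independence of \<open>S\<close> are known in \<open>L2 M\<close>;
  \<open>span_li_not_depend\<close> carries both over.\<close>

lemma dim_orthonormal_basis:
  assumes H: "L2_subspace M H" and S: "orthonormal M S" "L2.span M S = H"
  shows "vectorspace.dim class_ring (L2_sub M H) = card S"
proof -
  interpret H: vectorspace class_ring "L2_sub M H" by (rule L2.subspace_is_vs[OF H])
  note S' = orthonormalD[OF S(1)]
  have SH: "S \<subseteq> H" using L2.in_own_span[OF S'(2)] S(2) by simp
  have "H.basis S"
    unfolding H.basis_def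
    using L2.span_li_not_depend[OF SH L2_subspaceD(1)[OF H]] SH S(2)
      orthonormal_lin_indpt[OF S(1)] by simp
  then show ?thesis by (rule H.dim_basis[OF S'(1)])
qed

lemma orthonormal_card_le_dim:
  assumes H: "L2_subspace M H" and f: "vectorspace.fin_dim class_ring (L2_sub M H)"
    and S: "orthonormal M S" "S \<subseteq> H"
  shows "card S \<le> vectorspace.dim class_ring (L2_sub M H)"
proof -
  interpret H: vectorspace class_ring "L2_sub M H" by (rule L2.subspace_is_vs[OF H])
  show ?thesis
    using L2.span_li_not_depend[OF S(2) L2_subspaceD(1)[OF H]] S(2)
      orthonormal_lin_indpt[OF S(1)] by (intro H.li_le_dim f) simp_all
qed

section \<open>Fine partitions for atomless measures\<close>

text \<open>Repeated halving: a splitting of \<open>Y\<close> into two parts of positive measure has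
  a part with at most half the measure of \<open>Y\<close>. After \<open>n\<close> rounds the
  measure is at most that of \<open>X\<close> divided by \<open>2 ^ n\<close>.\<close>

lemma (in finite_measure) atomless_small_subset:
  assumes a: "atomless M" and X: "X \<in> sets M" "measure M X > 0" and e: "e > 0"
  obtains Y where "Y \<in> sets M" "Y \<subseteq> X" "0 < measure M Y" "measure M Y \<le> e"
proof -
  have halve: "\<exists>Y\<in>sets M. Y \<subseteq> X \<and> 0 < measure M Y \<and> measure M Y \<le> measure M X / 2 ^ n" for n
  proof (induction n)
    case 0
    show ?case using X by auto
  next
    case (Suc n)
    then obtain Y where Y: "Y \<in> sets M" "Y \<subseteq> X" "0 < measure M Y" "measure M Y \<le> measure M X / 2 ^ n"
      by blast
    obtain Z where Z: "Z \<in> sets M" "Z \<subseteq> Y" "0 < measure M Z" "measure M Z < measure M Y"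
      using a Y(1,3) unfolding atomless_def by blast
    have d: "measure M (Y - Z) = measure M Y - measure M Z"
      by (rule finite_measure_Diff[OF Y(1) Z(1,2)])
    show ?case
    proof (cases "measure M Z \<le> measure M Y / 2")
      case True
      then show ?thesis using Y Z by (intro bexI[of _ Z]) auto
    next
      case False
      then show ?thesis using Y Z d by (intro bexI[of _ "Y - Z"]) auto
    qed
  qed
  obtain n where n: "measure M X / e < 2 ^ n"
    using real_arch_pow[of 2 "measure M X / e"] by auto
  then have "measure M X / 2 ^ n \<le> e"
    using e by (simp add: field_simps)
  then show thesis using halve[of n] that by (meson order_trans)
qed

text \<open>Add the sets one at a time, each diminished by the union of what is already
  covered.\<close>

lemma finite_disjoint_refinement:
  assumes "finite P" "P \<subseteq> sets M"
  obtains Q where "finite Q" "Q \<subseteq> sets M" "disjoint Q" "\<Union>Q = \<Union>P"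
    "\<forall>Y\<in>Q. \<exists>Z\<in>P. Y \<subseteq> Z"
proof -
  have "\<exists>Q. finite Q \<and> Q \<subseteq> sets M \<and> disjoint Q \<and> \<Union>Q = \<Union>P \<and> (\<forall>Y\<in>Q. \<exists>Z\<in>P. Y \<subseteq> Z)"
    using assms
  proof (induction P rule: finite_induct)
    case empty
    show ?case by (intro exI[of _ "{}"]) (simp add: disjoint_def)
  next
    case (insert X P)
    then obtain Q where Q: "finite Q" "Q \<subseteq> sets M" "disjoint Q" "\<Union>Q = \<Union>P"
      "\<forall>Y\<in>Q. \<exists>Z\<in>P. Y \<subseteq> Z" by auto
    have "\<Union>Q \<in> sets M" using Q(1,2) by (simp add: sets.finite_Union)
    show ?case
    proof (intro exI[of _ "insert (X - \<Union>Q) Q"] conjI)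
      show "insert (X - \<Union>Q) Q \<subseteq> sets M"
        using insert.prems Q(2) sets.Diff[OF _ \<open>\<Union>Q \<in> sets M\<close>, of X] by simp
      show "disjoint (insert (X - \<Union>Q) Q)"
        using Q(3) unfolding disjoint_def by blast
      show "\<Union>(insert (X - \<Union>Q) Q) = \<Union>(insert X P)"
        using Q(4) by auto
      show "\<forall>Y\<in>insert (X - \<Union>Q) Q. \<exists>Z\<in>insert X P. Y \<subseteq> Z"
      proof
        fix Y assume Y: "Y \<in> insert (X - \<Union>Q) Q"
        show "\<exists>Z\<in>insert X P. Y \<subseteq> Z"
        proof (cases "Y \<in> Q")
          case True
          then obtain Z where "Z \<in> P" "Y \<subseteq> Z" using Q(5) by blast
          then show ?thesis by (intro bexI[of _ Z]) simp_all
        next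
          case False
          then show ?thesis using Y by (intro bexI[of _ X]) simp_all
        qed
      qed
    qed (use Q(1) in simp)
  qed
  then obtain Q where Q: "finite Q" "Q \<subseteq> sets M" "disjoint Q" "\<Union>Q = \<Union>P"
    "\<forall>Y\<in>Q. \<exists>Z\<in>P. Y \<subseteq> Z" by (elim exE conjE)
  then show thesis by (rule that)
qed

text \<open>Among the sets covered by finitely many sets of measure at most \<open>e\<close>, a maximising sequence
  exhausts the space: otherwise a small subset of what is left over could be added.\<close>

lemma (in prob_space) atomless_fine_partition:
  assumes a: "atomless M" and e: "e > 0"
  obtains P where "finite P" "P \<subseteq> sets M" "disjoint P" "\<Union>P = space M"
    "\<forall>Y\<in>P. measure M Y \<le> e"
proof -
  \<comment> \<open>Disjointness is not demanded, which makes \<open>good\<close> closed under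
    unions; the refinement at the end restores it.\<close>
  define good where "good A \<longleftrightarrow> (\<exists>P. finite P \<and> P \<subseteq> sets M \<and> \<Union>P = A \<and> (\<forall>Y\<in>P. measure M Y \<le> e))" for A
  have good_sets: "A \<in> sets M" if "good A" for A
    using that unfolding good_def by (auto intro: sets.finite_Union)
  have good_small: "good A" if "A \<in> sets M" "measure M A \<le> e" for A
    unfolding good_def using that by (intro exI[of _ "{A}"]) auto
  have good_Un: "good (A \<union> B)" if "good A" "good B" for A B
  proof -
    from that obtain P Q where "finite P" "P \<subseteq> sets M" "\<Union>P = A" "\<forall>Y\<in>P. measure M Y \<le> e"
      "finite Q" "Q \<subseteq> sets M" "\<Union>Q = B" "\<forall>Y\<in>Q. measure M Y \<le> e"
      unfolding good_def by blast
    then show ?thesis unfolding good_def by (intro exI[of _ "P \<union> Q"]) auto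
  qed
  let ?s = "SUP A\<in>Collect good. measure M A"
  have bdd: "bdd_above (measure M ` Collect good)"
    by (intro bdd_aboveI2[of _ _ 1]) auto
  have "good {}" unfolding good_def by (intro exI[of _ "{}"]) auto
  then have ne: "Collect good \<noteq> {}" by auto
  have s: "measure M A \<le> ?s" if "good A" for A
    using that by (intro cSUP_upper bdd) auto
  have "\<exists>A. good A \<and> ?s - 1 / real (Suc n) < measure M A" for n
    using less_cSUP_iff[OF ne bdd, of "?s - 1 / real (Suc n)"] by auto
  then obtain A where A: "\<And>n. good (A n)" "\<And>n. ?s - 1 / real (Suc n) < measure M (A n)"
    by metis
  have As: "A n \<in> sets M" for n using A(1) good_sets by blast
  let ?U = "\<Union>n. A n"
  have null: "measure M (space M - ?U) = 0"
  proof (rule ccontr)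
    assume "measure M (space M - ?U) \<noteq> 0"
    then have "measure M (space M - ?U) > 0" by (simp add: zero_less_measure_iff)
    then obtain C where C: "C \<in> sets M" "C \<subseteq> space M - ?U" "0 < measure M C" "measure M C \<le> e"
      using atomless_small_subset[OF a _ _ e, of "space M - ?U"] As by blast
    \<comment> \<open>This \<open>A n\<close> falls short of the supremum by less than the measure
      of \<open>C\<close>, and \<open>C\<close> is disjoint from it, so adding \<open>C\<close>
      would exceed the supremum.\<close>
    obtain n where n: "1 / real (Suc n) < measure M C"
      using reals_Archimedean[OF C(3)] by (auto simp: inverse_eq_divide)
    have "measure M (A n \<union> C) = measure M (A n) + measure M C"
      using C As by (intro finite_measure_Union) auto
    moreover have "measure M (A n \<union> C) \<le> ?s"
      using C(1,4) by (intro s good_Un[OF A(1) good_small])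
    ultimately show False using n A(2)[of n] by linarith
  qed
  let ?B = "\<lambda>n. \<Union>k\<le>n. A k"
  have B: "good (?B n)" for n
    by (induction n) (auto simp: atMost_Suc A(1) Un_commute intro: good_Un)
  have "(\<lambda>n. measure M (?B n)) \<longlonglongrightarrow> measure M (\<Union>n. ?B n)"
    using As by (intro finite_Lim_measure_incseq) (auto simp: incseq_def intro: order_trans)
  moreover have "(\<Union>n. ?B n) = ?U" by auto
  moreover have "measure M ?U = 1"
    using null prob_compl[of ?U] As by auto
  ultimately have "(\<lambda>n. measure M (?B n)) \<longlonglongrightarrow> 1" by simp
  then have "\<forall>\<^sub>F n in sequentially. 1 - e < measure M (?B n)"
    using e by (intro order_tendstoD) auto
  then obtain n where n: "1 - e < measure M (?B n)"
    by (auto simp: eventually_sequentially)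
  \<comment> \<open>The countable union is replaced by a finite one: once less than \<open>e\<close>
    is left uncovered, the remainder is itself a single small set.\<close>
  have "good (space M - ?B n)"
    using n B good_sets prob_compl[of "?B n"] by (intro good_small) auto
  from good_Un[OF B[of n] this] have "good (space M)"
    using sets.sets_into_space[OF good_sets[OF B[of n]]] by (simp add: Un_absorb1)
  then obtain P where P: "finite P" "P \<subseteq> sets M" "\<Union>P = space M" "\<forall>Y\<in>P. measure M Y \<le> e"
    unfolding good_def by blast
  obtain Q where Q: "finite Q" "Q \<subseteq> sets M" "disjoint Q" "\<Union>Q = \<Union>P"
    "\<forall>Y\<in>Q. \<exists>Z\<in>P. Y \<subseteq> Z"
    by (rule finite_disjoint_refinement[OF P(1,2)])
  have "\<forall>Y\<in>Q. measure M Y \<le> e"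
  \<comment> \<open>Each piece of the refinement lies in a member of \<open>P\<close>, so the bound
    on the measures persists.\<close>
  proof
    fix Y assume Y: "Y \<in> Q"
    obtain Z where Z: "Z \<in> P" "Y \<subseteq> Z" using bspec[OF Q(5) Y] by (rule bexE)
    have "Z \<in> sets M" using P(2) Z(1) by (rule subsetD)
    then have "measure M Y \<le> measure M Z" by (rule finite_measure_mono[OF Z(2)])
    also have "\<dots> \<le> e" using P(4) Z(1) by (rule bspec)
    finally show "measure M Y \<le> e" .
  qed
  with Q(1-3) Q(4)[unfolded P(3)] show thesis by (rule that)
qed

section \<open>Estimates for the \<open>\<mu>\<close>-dimension\<close>

lemma L2_opnorm_least:
  assumes "\<And>u. u \<in> carrier (L2 M) \<Longrightarrow> L2_norm M u \<le> 1 \<Longrightarrow> L2_norm M (W u) \<le> b"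
  shows "L2_opnorm M W \<le> b"
  unfolding L2_opnorm_def
proof (rule cSup_least)
  show "{L2_norm M (W u) |u. u \<in> carrier (L2 M) \<and> L2_norm M u \<le> 1} \<noteq> {}"
    using L2_norm_zero[of M] by (auto intro!: exI[of _ "\<zero>\<^bsub>L2 M\<^esub>"])
qed (use assms in auto)

text \<open>A real supremum bounds its set only if the set is bounded above; \<open>b\<close> is
  there to certify this and does not enter the conclusion.\<close>

lemma L2_opnorm_upper:
  assumes "\<And>u. u \<in> carrier (L2 M) \<Longrightarrow> L2_norm M u \<le> 1 \<Longrightarrow> L2_norm M (W u) \<le> b"
    and "u \<in> carrier (L2 M)" "L2_norm M u \<le> 1"
  shows "L2_norm M (W u) \<le> L2_opnorm M W"
  unfolding L2_opnorm_def
proof (rule cSup_upper)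
  show "bdd_above {L2_norm M (W u) |u. u \<in> carrier (L2 M) \<and> L2_norm M u \<le> 1}"
    using assms(1) by (auto intro!: bdd_aboveI[of _ b])
qed (use assms in auto)

lemma L2_opnorm_nonneg:
  assumes "\<And>u. u \<in> carrier (L2 M) \<Longrightarrow> L2_norm M u \<le> 1 \<Longrightarrow> L2_norm M (W u) \<le> b"
  shows "0 \<le> L2_opnorm M W"
proof -
  have "L2_norm M (W \<zero>\<^bsub>L2 M\<^esub>) \<le> L2_opnorm M W"
    by (rule L2_opnorm_upper[OF assms]) (simp_all add: L2_norm_zero)
  then show ?thesis using L2_norm_nonneg order_trans by blast
qed

text \<open>The infimum is over square roots and is squared afterwards. By monotonicity of the
  square root it suffices to find the infimum of \<open>mu_M\<close> itself: a lower bound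
  \<open>c\<close> that is approached to within any \<open>e\<close>.\<close>

lemma mu_dim_eqI:
  assumes c: "0 \<le> c"
    and lower: "\<And>P. P \<in> ae_partitions M \<Longrightarrow> c \<le> mu_M M P (L2_proj M H)"
    and approx: "\<And>e. e > 0 \<Longrightarrow> \<exists>P\<in>ae_partitions M. mu_M M P (L2_proj M H) \<le> c + e"
  shows "mu_dim M H = c"
proof (rule antisym)
  let ?n = "mu_norm M (L2_proj M H)"
  have ne: "ae_partitions M \<noteq> {}" using approx[of 1] by auto
  have bdd: "bdd_below ((\<lambda>P. sqrt (mu_M M P (L2_proj M H))) ` ae_partitions M)"
    using lower by (intro bdd_belowI2[of _ "sqrt c"]) simp
  have n: "sqrt c \<le> ?n"
    unfolding mu_norm_def using lower by (intro cINF_greatest[OF ne]) simp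
  moreover have n0: "0 \<le> ?n" using n c by (meson order_trans real_sqrt_ge_zero)
  ultimately show "c \<le> mu_dim M H"
    unfolding mu_dim_def using c by (metis real_sqrt_ge_zero power_mono real_sqrt_pow2)
  show "mu_dim M H \<le> c"
  proof (rule field_le_epsilon)
    fix e :: real assume e: "e > 0"
    obtain P where P: "P \<in> ae_partitions M" "mu_M M P (L2_proj M H) \<le> c + e"
      using approx[OF e] by blast
    have "?n \<le> sqrt (mu_M M P (L2_proj M H))"
      unfolding mu_norm_def by (rule cINF_lower[OF bdd P(1)])
    also have "\<dots> \<le> sqrt (c + e)" using P(2) by simp
    finally have "?n\<^sup>2 \<le> (sqrt (c + e))\<^sup>2" using n0 by (rule power_mono)
    then show "mu_dim M H \<le> c + e" unfolding mu_dim_def using c e by simp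
  qed
qed

lemma disjoint_in_ae_partitions:
  assumes "finite P" "P \<subseteq> sets M" "disjoint P" "\<Union>P = space M"
  shows "P \<in> ae_partitions M"
  using assms by (auto simp: ae_partitions_def disjoint_def)

section \<open>Normalised indicators, atoms and bounds for the projection restricted to a
  set\<close>

definition L2_unit :: "'a measure \<Rightarrow> 'a set \<Rightarrow> ('a \<Rightarrow> complex) set" where
  "L2_unit M A = L2_class M (\<lambda>x. complex_of_real (indicator A x / sqrt (measure M A)))"

context finite_measure
begin

text \<open>For a null set the division by zero yields the zero function, so this covers every
  measurable \<open>A\<close>; unit norm requires positive measure.\<close>

lemma sq_integrable_unit:
  assumes "A \<in> sets M"
  shows "(\<lambda>x. complex_of_real (indicator A x / sqrt (measure M A))) \<in> sq_integrable M"
proof -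
  have "(\<lambda>x. (cmod (complex_of_real (indicator A x / sqrt (measure M A))))\<^sup>2)
      = (\<lambda>x. indicator A x / measure M A)"
    by (intro ext, simp only: norm_of_real) (auto simp: indicator_def power_divide)
  then show ?thesis
    using assms by (simp add: sq_integrable_def less_top[symmetric])
qed

lemma L2_unit_closed: "A \<in> sets M \<Longrightarrow> L2_unit M A \<in> carrier (L2 M)"
  unfolding L2_unit_def by (intro L2_class_in_carrier sq_integrable_unit)

lemma L2_norm_unit:
  assumes "A \<in> sets M" "measure M A > 0"
  shows "L2_norm M (L2_unit M A) = 1"
proof -
  have "(\<lambda>x. (cmod (complex_of_real (indicator A x / sqrt (measure M A))))\<^sup>2)
      = (\<lambda>x. indicator A x / measure M A)"
    by (intro ext, simp only: norm_of_real) (auto simp: indicator_def power_divide)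
  then have "(L2_norm M (L2_unit M A))\<^sup>2 = 1"
    unfolding L2_unit_def L2_norm_class_sq[OF sq_integrable_unit[OF assms(1)]]
    using assms sets.sets_into_space[OF assms(1)] by (simp add: Int_absorb2)
  then show ?thesis using L2_norm_nonneg[of M "L2_unit M A"] by (simp add: power2_eq_1_iff)
qed

lemma L2_indicator_proj_unit:
  assumes "A \<in> sets M" "B \<in> sets M" "A \<subseteq> B"
  shows "L2_indicator_proj M B (L2_unit M A) = L2_unit M A"
proof -
  have "(\<lambda>x. indicator B x * complex_of_real (indicator A x / sqrt (measure M A)))
      = (\<lambda>x. complex_of_real (indicator A x / sqrt (measure M A)))"
    using assms(3) by (intro ext) (auto simp: indicator_def)
  then show ?thesis
    unfolding L2_unit_def L2_indicator_proj_class[OF sq_integrable_unit[OF assms(1)] assms(2)]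
    by simp
qed

text \<open>Only the value of a representative \<open>f\<close> at \<open>x\<close> enters: both
  sides equal \<open>measure M {x} * (cmod (f x))^2\<close>.\<close>

lemma L2_inner_unit_atom:
  assumes x: "{x} \<in> sets M" "measure M {x} > 0" and v: "v \<in> carrier (L2 M)"
  shows "(cmod (L2_inner M (L2_unit M {x}) v))\<^sup>2 = (L2_norm M (L2_indicator_proj M {x} v))\<^sup>2"
proof -
  obtain f where f: "f \<in> sq_integrable M" "v = L2_class M f" by (rule L2_cases[OF v])
  let ?m = "measure M {x}"
  have s: "{x} \<inter> space M = {x}" using sets.sets_into_space[OF x(1)] by auto
  have "L2_inner M (L2_unit M {x}) v
      = (\<integral>y. complex_of_real (indicator {x} y / sqrt ?m) * cnj (f y) \<partial>M)"
    unfolding L2_unit_def f(2) by (rule L2_inner_class[OF sq_integrable_unit[OF x(1)] f(1)])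
  also have "\<dots> = (\<integral>y. indicator {x} y *\<^sub>R (cnj (f x) / complex_of_real (sqrt ?m)) \<partial>M)"
    by (intro Bochner_Integration.integral_cong refl) (auto simp: indicator_def)
  also have "\<dots> = ?m *\<^sub>R (cnj (f x) / complex_of_real (sqrt ?m))"
    using x s by (simp add: less_top[symmetric])
  finally have "(cmod (L2_inner M (L2_unit M {x}) v))\<^sup>2 = (?m * (cmod (f x) / sqrt ?m))\<^sup>2"
    using x(2) by (simp add: norm_mult norm_divide)
  also have "\<dots> = ?m * (cmod (f x))\<^sup>2"
    using x(2) by (simp add: power_mult_distrib power_divide power2_eq_square)
  also have "\<dots> = (\<integral>y. indicator {x} y *\<^sub>R (cmod (f x))\<^sup>2 \<partial>M)"
    using x s by (simp add: less_top[symmetric])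
  also have "\<dots> = (\<integral>y. indicator {x} y * (cmod (f y))\<^sup>2 \<partial>M)"
    by (intro Bochner_Integration.integral_cong refl) (auto simp: indicator_def)
  finally show ?thesis
    unfolding f(2) L2_norm_indicator_proj_sq[OF f(1) x(1)] .
qed

text \<open>Bessel's inequality for the unit vector at \<open>x\<close>. Summed over the points of a
  finite uniform space, it bounds the size of an orthonormal set.\<close>

lemma orthonormal_atom_le_1:
  assumes S: "orthonormal M S" and x: "{x} \<in> sets M" "measure M {x} > 0"
  shows "(\<Sum>v\<in>S. (L2_norm M (L2_indicator_proj M {x} v))\<^sup>2) \<le> 1"
proof -
  have "(\<Sum>v\<in>S. (L2_norm M (L2_indicator_proj M {x} v))\<^sup>2)
      = (\<Sum>v\<in>S. (cmod (L2_inner M (L2_unit M {x}) v))\<^sup>2)"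
    using orthonormalD(2)[OF S] by (intro sum.cong refl) (auto simp: L2_inner_unit_atom[OF x])
  then show ?thesis
    using L2_Bessel[OF S L2_unit_closed[OF x(1)]] L2_norm_unit[OF x] by simp
qed

end

text \<open>Self-adjointness moves the indicator from \<open>u\<close> to the basis vectors, where
  Cauchy-Schwarz applies. The bound also certifies boundedness for the lemmas on
  \<open>L2_opnorm\<close>.\<close>

lemma L2_norm_proj_indicator_le:
  assumes H: "L2_subspace M H" and S: "orthonormal M S" "L2.span M S = H"
    and Y: "Y \<in> sets M" and u: "u \<in> carrier (L2 M)" "L2_norm M u \<le> 1"
  shows "L2_norm M ((L2_proj M H \<circ> L2_indicator_proj M Y) u)
    \<le> sqrt (\<Sum>v\<in>S. (L2_norm M (L2_indicator_proj M Y v))\<^sup>2)"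
proof (rule real_le_rsqrt)
  have "(L2_norm M ((L2_proj M H \<circ> L2_indicator_proj M Y) u))\<^sup>2
      = (\<Sum>v\<in>S. (cmod (L2_inner M (L2_indicator_proj M Y u) v))\<^sup>2)"
    using L2_norm_proj_sq[OF H S L2_indicator_proj_closed[OF u(1) Y]] by simp
  also have "\<dots> \<le> (\<Sum>v\<in>S. (L2_norm M (L2_indicator_proj M Y v))\<^sup>2)"
  proof (rule sum_mono)
    fix v assume "v \<in> S"
    then have v: "v \<in> carrier (L2 M)" using orthonormalD(2)[OF S(1)] by blast
    have "cmod (L2_inner M u (L2_indicator_proj M Y v)) \<le> L2_norm M u * L2_norm M (L2_indicator_proj M Y v)"
      by (rule L2_Cauchy_Schwarz[OF u(1) L2_indicator_proj_closed[OF v Y]])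
    also have "\<dots> \<le> L2_norm M (L2_indicator_proj M Y v)"
      using u(2) by (intro mult_left_le_one_le L2_norm_nonneg)
    finally show "(cmod (L2_inner M (L2_indicator_proj M Y u) v))\<^sup>2 \<le> (L2_norm M (L2_indicator_proj M Y v))\<^sup>2"
      unfolding L2_inner_indicator_proj[OF u(1) v Y] by (intro power_mono) simp_all
  qed
  finally show "(L2_norm M ((L2_proj M H \<circ> L2_indicator_proj M Y) u))\<^sup>2
    \<le> (\<Sum>v\<in>S. (L2_norm M (L2_indicator_proj M Y v))\<^sup>2)" .
qed

lemma L2_opnorm_proj_indicator_le:
  assumes "L2_subspace M H" "orthonormal M S" "L2.span M S = H" "Y \<in> sets M"
  shows "(L2_opnorm M (L2_proj M H \<circ> L2_indicator_proj M Y))\<^sup>2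
    \<le> (\<Sum>v\<in>S. (L2_norm M (L2_indicator_proj M Y v))\<^sup>2)"
proof -
  let ?b = "sqrt (\<Sum>v\<in>S. (L2_norm M (L2_indicator_proj M Y v))\<^sup>2)"
  note b = L2_norm_proj_indicator_le[OF assms]
  have "0 \<le> L2_opnorm M (L2_proj M H \<circ> L2_indicator_proj M Y)"
    by (rule L2_opnorm_nonneg) (rule b)
  moreover have "L2_opnorm M (L2_proj M H \<circ> L2_indicator_proj M Y) \<le> ?b"
    by (rule L2_opnorm_least) (rule b)
  ultimately have "(L2_opnorm M (L2_proj M H \<circ> L2_indicator_proj M Y))\<^sup>2 \<le> ?b\<^sup>2"
    by (intro power_mono)
  then show ?thesis by (simp add: sum_nonneg)
qed

text \<open>The unit vector at \<open>x\<close> is unchanged by the indicator of \<open>Y\<close>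
  because \<open>x\<close> lies in \<open>Y\<close>, so its projection onto \<open>H\<close> bounds
  the operator norm from below.\<close>

lemma (in finite_measure) L2_opnorm_proj_indicator_ge_atom:
  assumes H: "L2_subspace M H" and S: "orthonormal M S" "L2.span M S = H"
    and Y: "Y \<in> sets M" and x: "x \<in> Y" "{x} \<in> sets M" "measure M {x} > 0"
  shows "(\<Sum>v\<in>S. (L2_norm M (L2_indicator_proj M {x} v))\<^sup>2)
    \<le> (L2_opnorm M (L2_proj M H \<circ> L2_indicator_proj M Y))\<^sup>2"
proof -
  let ?e = "L2_unit M {x}"
  have e: "?e \<in> carrier (L2 M)" by (rule L2_unit_closed[OF x(2)])
  have "(\<Sum>v\<in>S. (L2_norm M (L2_indicator_proj M {x} v))\<^sup>2)
      = (\<Sum>v\<in>S. (cmod (L2_inner M ?e v))\<^sup>2)"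
    using orthonormalD(2)[OF S(1)]
    by (intro sum.cong refl) (auto simp: L2_inner_unit_atom[OF x(2,3)])
  also have "\<dots> = (L2_norm M ((L2_proj M H \<circ> L2_indicator_proj M Y) ?e))\<^sup>2"
    using L2_norm_proj_sq[OF H S e] x L2_indicator_proj_unit[OF x(2) Y] by simp
  also have "\<dots> \<le> (L2_opnorm M (L2_proj M H \<circ> L2_indicator_proj M Y))\<^sup>2"
  proof (rule power_mono[OF L2_opnorm_upper L2_norm_nonneg])
    show "L2_norm M ?e \<le> 1" using L2_norm_unit[OF x(2,3)] by simp
  qed (rule L2_norm_proj_indicator_le[OF H S Y], assumption+, rule e)
  finally show ?thesis .
qed

text \<open>Replace every weight by \<open>d\<close>, bound the operator norms by sums over
  \<open>S\<close> and exchange the sums. Pythagoras over the partition then gives 1 for each basis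
  vector.\<close>

lemma mu_M_proj_le:
  assumes H: "L2_subspace M H" and S: "orthonormal M S" "L2.span M S = H"
    and P: "finite P" "P \<subseteq> sets M" "disjoint P" "\<Union>P = space M"
    and d: "\<And>Y. Y \<in> P \<Longrightarrow> measure M Y \<le> d"
  shows "mu_M M P (L2_proj M H) \<le> d * card S"
proof -
  let ?N = "\<lambda>Y v. (L2_norm M (L2_indicator_proj M Y v))\<^sup>2"
  have "mu_M M P (L2_proj M H) \<le> (\<Sum>Y\<in>P. d * (\<Sum>v\<in>S. ?N Y v))"
    unfolding mu_M_def
  proof (rule sum_mono)
    fix Y assume Y: "Y \<in> P"
    then have "Y \<in> sets M" using P(2) by blast
    then show "measure M Y * (L2_opnorm M (L2_proj M H \<circ> L2_indicator_proj M Y))\<^sup>2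
        \<le> d * (\<Sum>v\<in>S. ?N Y v)"
      using L2_opnorm_proj_indicator_le[OF H S] d[OF Y] order_trans[OF measure_nonneg d[OF Y]]
      by (intro mult_mono) auto
  qed
  also have "\<dots> = d * (\<Sum>v\<in>S. \<Sum>Y\<in>P. ?N Y v)"
    \<comment> \<open>Cancelling \<open>d\<close> leaves a disjunction whose second alternative is
      the exchange of the two sums.\<close>
    by (simp add: sum_distrib_left[symmetric]) (rule disjI2, rule sum.swap)
  also have "(\<Sum>v\<in>S. \<Sum>Y\<in>P. ?N Y v) = (\<Sum>v\<in>S. 1)"
  proof (rule sum.cong[OF refl])
    fix v assume v: "v \<in> S"
    then have vc: "v \<in> carrier (L2 M)" using orthonormalD(2)[OF S(1)] by blast
    have "complex_of_real ((L2_norm M v)\<^sup>2) = 1"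
      using orthonormalD(3)[OF S(1) v v] L2_inner_self[OF vc] by simp
    then show "(\<Sum>Y\<in>P. ?N Y v) = 1"
      unfolding sum_L2_norm_indicator_proj[OF vc P] by (simp only: of_real_eq_1_iff)
  qed
  finally show ?thesis by simp
qed

section \<open>The three evaluations of the dimension\<close>

lemma (in prob_space) mu_dim_fin_dim_atomless:
  assumes H: "L2_subspace M H" and a: "atomless M"
    and f: "vectorspace.fin_dim class_ring (L2_sub M H)"
  shows "mu_dim M H = 0"
proof -
  obtain S where S: "orthonormal M S" "L2.span M S = H"
    by (rule orthonormal_basis_exists[OF H orthonormal_card_le_dim[OF H f]])
  show ?thesis
  proof (rule mu_dim_eqI)
    fix P show "0 \<le> mu_M M P (L2_proj M H)"
      unfolding mu_M_def by (intro sum_nonneg) simp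
  next
    fix e :: real assume e: "e > 0"
    \<comment> \<open>The added 1 keeps the denominator positive when \<open>H\<close> is the zero
      space and \<open>S\<close> is empty.\<close>
    have d: "e / (real (card S) + 1) > 0" using e by simp
    obtain P where P: "finite P" "P \<subseteq> sets M" "disjoint P" "\<Union>P = space M"
      "\<forall>Y\<in>P. measure M Y \<le> e / (real (card S) + 1)"
      by (rule atomless_fine_partition[OF a d])
    have "mu_M M P (L2_proj M H) \<le> e / (real (card S) + 1) * card S"
      by (rule mu_M_proj_le[OF H S P(1-4)]) (use P(5) in blast)
    also have "\<dots> \<le> e" using e by (simp add: field_simps)
    finally show "\<exists>P\<in>ae_partitions M. mu_M M P (L2_proj M H) \<le> 0 + e"
      using disjoint_in_ae_partitions[OF P(1-4)] by auto
  qed simp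
qed

text \<open>Multiplication by the indicator of \<open>X\<close> is self-adjoint and idempotent, so
  what it removes from \<open>u\<close> is orthogonal to its range.\<close>

lemma L2_proj_indicator_range:
  assumes H: "L2_subspace M H" and X: "X \<in> sets M" "H = L2_indicator_proj M X ` carrier (L2 M)"
    and u: "u \<in> carrier (L2 M)"
  shows "L2_proj M H u = L2_indicator_proj M X u"
proof (rule L2_proj_eqI[OF H u])
  show "L2_indicator_proj M X u \<in> H" using X u by blast
  fix w assume "w \<in> H"
  then obtain v where v: "v \<in> carrier (L2 M)" "w = L2_indicator_proj M X v" using X by blast
  note c = L2_indicator_proj_closed[OF u X(1)] L2_indicator_proj_closed[OF v(1) X(1)]
  have "L2_inner M (L2_indicator_proj M X u) w = L2_inner M u w"
    unfolding v(2) L2_inner_indicator_proj[OF u c(2) X(1)] L2_indicator_proj_Int[OF v(1) X(1) X(1)]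
    by simp
  then show "L2_inner M (u \<ominus>\<^bsub>L2 M\<^esub> L2_indicator_proj M X u) w = 0"
    using u c v(2) by (simp add: L2_inner_minus_left)
qed

text \<open>The composite acts as multiplication by the indicator of the intersection of
  \<open>X\<close> and \<open>Y\<close>. A set meeting \<open>X\<close> in positive measure thus
  contributes its full measure, which is at least that of the intersection.\<close>

lemma (in prob_space) mu_dim_indicator_range:
  assumes H: "L2_subspace M H" and X: "X \<in> sets M" "H = L2_indicator_proj M X ` carrier (L2 M)"
  shows "mu_dim M H = measure M X"
proof (rule mu_dim_eqI)
  let ?W = "\<lambda>Y. L2_proj M H \<circ> L2_indicator_proj M Y"
  have W: "?W Y u = L2_indicator_proj M (X \<inter> Y) u" if "u \<in> carrier (L2 M)" "Y \<in> sets M" for Y u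
    using that X(1)
    by (simp add: L2_proj_indicator_range[OF H X] L2_indicator_proj_closed L2_indicator_proj_Int)
  have b: "L2_norm M (?W Y u) \<le> 1" if "u \<in> carrier (L2 M)" "L2_norm M u \<le> 1" "Y \<in> sets M" for Y u
    using L2_norm_indicator_proj_le[OF that(1), of "X \<inter> Y"] that X(1) W by (simp add: sets.Int)
  {
    fix P assume "P \<in> ae_partitions M"
    then have P: "finite P" "P \<subseteq> sets M" "measure M (space M - \<Union>P) = 0"
      by (auto simp: ae_partitions_def)
    have U: "\<Union>P \<in> sets M" using P(1,2) by (rule sets.finite_Union)
    \<comment> \<open>Only a null part of \<open>X\<close> is left uncovered. Subadditivity then
      suffices for the lower bound, whatever the overlaps.\<close>
    have "measure M X = measure M (X - (space M - \<Union>P))"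
      using X(1) U P(3) by (intro measure_Diff_null_set[symmetric]) (auto simp: emeasure_eq_measure)
    also have "X - (space M - \<Union>P) = (\<Union>Y\<in>P. X \<inter> Y)"
      using sets.sets_into_space[OF X(1)] by auto
    also have "measure M (\<Union>Y\<in>P. X \<inter> Y) \<le> (\<Sum>Y\<in>P. measure M (X \<inter> Y))"
      using P X(1) by (intro finite_measure_subadditive_finite) auto
    also have "\<dots> \<le> mu_M M P (L2_proj M H)"
      unfolding mu_M_def
    proof (rule sum_mono)
      fix Y assume "Y \<in> P"
      then have Y: "Y \<in> sets M" using P(2) by blast
      show "measure M (X \<inter> Y) \<le> measure M Y * (L2_opnorm M (?W Y))\<^sup>2"
      proof (cases "measure M (X \<inter> Y) = 0")
        case False
        then have A: "X \<inter> Y \<in> sets M" "measure M (X \<inter> Y) > 0"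
          using X(1) Y by (auto simp: zero_less_measure_iff)
        let ?e = "L2_unit M (X \<inter> Y)"
        have e: "?e \<in> carrier (L2 M)" by (rule L2_unit_closed[OF A(1)])
        have "1 = L2_norm M (?W Y ?e)"
          using W[OF e Y] L2_indicator_proj_unit[OF A(1) A(1)] L2_norm_unit[OF A] by simp
        also have "\<dots> \<le> L2_opnorm M (?W Y)"
        proof (rule L2_opnorm_upper)
          show "L2_norm M ?e \<le> 1" using L2_norm_unit[OF A] by simp
        qed (rule b[OF _ _ Y], assumption+, rule e)
        finally have "1 \<le> (L2_opnorm M (?W Y))\<^sup>2" by (simp add: one_le_power)
        moreover have "measure M (X \<inter> Y) \<le> measure M Y"
          using Y by (intro finite_measure_mono) auto
        ultimately show ?thesis
          using mult_mono[of "measure M (X \<inter> Y)" "measure M Y" 1] by simp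
      qed simp
    qed
    finally show "measure M X \<le> mu_M M P (L2_proj M H)" .
  next
    fix e :: real assume e: "e > 0"
    let ?P = "{X, space M - X}"
    \<comment> \<open>The two members are distinct because the space is nonempty, so the sum over
      the two-element set really has two terms.\<close>
    have ne: "X \<noteq> space M - X"
      using not_empty sets.sets_into_space[OF X(1)] by auto
    have P: "?P \<in> ae_partitions M"
      using X(1) sets.sets_into_space[OF X(1)]
      by (intro disjoint_in_ae_partitions) (auto simp: disjoint_def)
    have n0: "0 \<le> L2_opnorm M (?W Y)" if "Y \<in> sets M" for Y
      by (rule L2_opnorm_nonneg) (rule b[OF _ _ that])
    have "L2_opnorm M (?W X) \<le> 1" by (rule L2_opnorm_least) (rule b[OF _ _ X(1)])
    then have 1: "(L2_opnorm M (?W X))\<^sup>2 \<le> 1" using n0[OF X(1)] by (simp add: power_le_one)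
    have C: "space M - X \<in> sets M" using X(1) by blast
    have "L2_opnorm M (?W (space M - X)) \<le> 0"
      using W[OF _ C] by (intro L2_opnorm_least) (simp add: L2_indicator_proj_null L2_norm_zero)
    then have 2: "L2_opnorm M (?W (space M - X)) = 0" using n0[OF C] by simp
    have "mu_M M ?P (L2_proj M H) \<le> measure M X"
      unfolding mu_M_def using ne 2 mult_left_le[OF 1, of "measure M X"] by simp
    then show "\<exists>P\<in>ae_partitions M. mu_M M P (L2_proj M H) \<le> measure M X + e"
      using P e by (intro bexI[OF _ P]) simp
  }
qed simp

text \<open>Each point has mass \<open>1 / J\<close>, and the squared norms of the basis vectors
  restricted to single points add up to \<open>card S\<close>. Both bounds compare
  \<open>mu_M\<close> with \<open>1 / J\<close> times this double sum.\<close>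

lemma (in prob_space) mu_dim_uniform:
  assumes fin: "finite (space M)"
    and unif: "\<And>X. X \<subseteq> space M \<Longrightarrow> X \<in> sets M \<and> measure M X = real (card X) / real (card (space M))"
    and H: "L2_subspace M H"
  shows "mu_dim M H = real (vectorspace.dim class_ring (L2_sub M H)) / real (card (space M))"
proof -
  let ?J = "real (card (space M))"
  let ?N = "\<lambda>Y v. (L2_norm M (L2_indicator_proj M Y v))\<^sup>2"
  let ?P = "(\<lambda>x. {x}) ` space M"
  have J: "?J > 0" using fin not_empty by (simp add: card_gt_0_iff)
  have x: "{x} \<in> sets M" "measure M {x} = 1 / ?J" "measure M {x} > 0" if "x \<in> space M" for x
    using unif[of "{x}"] that J by auto
  have P: "finite ?P" "?P \<subseteq> sets M" "disjoint ?P" "\<Union>?P = space M"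
    using fin x(1) by (auto simp: disjoint_def)
  have atoms: "(\<Sum>x\<in>space M. \<Sum>v\<in>S. ?N {x} v) = card S" if S: "orthonormal M S" for S
  proof -
    have "(\<Sum>x\<in>space M. ?N {x} v) = 1" if v: "v \<in> S" for v
    proof -
      have vc: "v \<in> carrier (L2 M)" using v orthonormalD(2)[OF S] by blast
      have "complex_of_real ((L2_norm M v)\<^sup>2) = 1"
        using orthonormalD(3)[OF S v v] L2_inner_self[OF vc] by simp
      then have "(L2_norm M v)\<^sup>2 = 1" by (simp only: of_real_eq_1_iff)
      then show ?thesis
        using sum_L2_norm_indicator_proj[OF vc P] by (simp add: sum.reindex)
    qed
    then show ?thesis by (subst sum.swap) simp
  qed
  \<comment> \<open>The double sum equals \<open>card S\<close>, while each point contributes at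
    most 1.\<close>
  have "card S \<le> card (space M)" if S: "orthonormal M S" for S
  proof -
    have "real (card S) \<le> (\<Sum>x\<in>space M. 1)"
      unfolding atoms[OF S, symmetric] using x by (intro sum_mono orthonormal_atom_le_1[OF S])
    then show ?thesis by simp
  qed
  then obtain S where S: "orthonormal M S" "L2.span M S = H"
    using orthonormal_basis_exists[OF H] by metis
  show ?thesis
    unfolding dim_orthonormal_basis[OF H S]
  proof (rule mu_dim_eqI)
    fix P assume "P \<in> ae_partitions M"
    then have P': "finite P" "P \<subseteq> sets M" "measure M (space M - \<Union>P) = 0"
      "\<And>Y Z. Y \<in> P \<Longrightarrow> Z \<in> P \<Longrightarrow> Y \<noteq> Z \<Longrightarrow> measure M (Y \<inter> Z) = 0"
      by (auto simp: ae_partitions_def)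
    have sub: "Y \<subseteq> space M" if "Y \<in> P" for Y
      using that P'(2) sets.sets_into_space by blast
    \<comment> \<open>Null sets are empty here, so an almost-everywhere partition is a genuine one
      and sums over points can be grouped by its members.\<close>
    have null: "A = {}" if "A \<subseteq> space M" "measure M A = 0" for A
      using unif[OF that(1)] that J finite_subset[OF that(1) fin] by auto
    have cover: "space M = \<Union>P" using null[OF _ P'(3)] sub by blast
    have dj: "Y \<inter> Z = {}" if "Y \<in> P" "Z \<in> P" "Y \<noteq> Z" for Y Z
      using that sub by (intro null P'(4)) auto
    have "real (card S) / ?J = (\<Sum>x\<in>\<Union>P. 1 / ?J * (\<Sum>v\<in>S. ?N {x} v))"
      unfolding atoms[OF S(1), symmetric] cover[symmetric] by (simp flip: sum_divide_distrib)
    also have "\<dots> = (\<Sum>Y\<in>P. \<Sum>x\<in>Y. 1 / ?J * (\<Sum>v\<in>S. ?N {x} v))"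
      using finite_subset[OF sub fin] dj by (subst sum.Union_disjoint) simp_all
    also have "\<dots> \<le> mu_M M P (L2_proj M H)"
      unfolding mu_M_def
    proof (rule sum_mono)
      fix Y assume Y: "Y \<in> P"
      then have Ys: "Y \<in> sets M" using P'(2) by blast
      let ?o = "(L2_opnorm M (L2_proj M H \<circ> L2_indicator_proj M Y))\<^sup>2"
      \<comment> \<open>One operator norm dominates the contribution of every point of
        \<open>Y\<close>, and the masses of these points add up to the measure of
        \<open>Y\<close>.\<close>
      have "(\<Sum>x\<in>Y. 1 / ?J * (\<Sum>v\<in>S. ?N {x} v)) \<le> (\<Sum>x\<in>Y. 1 / ?J * ?o)"
      proof (intro sum_mono mult_left_mono)
        fix x assume "x \<in> Y"
        with sub[OF Y] have "x \<in> space M" by blast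
        then show "(\<Sum>v\<in>S. ?N {x} v) \<le> ?o"
          by (intro L2_opnorm_proj_indicator_ge_atom[OF H S Ys \<open>x \<in> Y\<close>] x)
      qed simp
      also have "\<dots> = measure M Y * ?o" using unif[OF sub[OF Y]] by simp
      finally show "(\<Sum>x\<in>Y. 1 / ?J * (\<Sum>v\<in>S. ?N {x} v)) \<le> measure M Y * ?o" .
    qed
    finally show "real (card S) / ?J \<le> mu_M M P (L2_proj M H)" .
  next
    fix e :: real assume "e > 0"
    \<comment> \<open>Singletons attain the bound, with \<open>1 / J\<close> as the common measure
      \<open>d\<close>.\<close>
    have "mu_M M ?P (L2_proj M H) \<le> 1 / ?J * card S"
      using x(2) by (intro mu_M_proj_le[OF H S P]) auto
    then show "\<exists>P\<in>ae_partitions M. mu_M M P (L2_proj M H) \<le> real (card S) / ?J + e"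
      using disjoint_in_ae_partitions[OF P] \<open>e > 0\<close> by (intro bexI[of _ ?P]) auto
  qed simp
qed

theorem lemma3p4:
  fixes M :: "'a measure"
  assumes "prob_space M"
  shows
    "(\<forall>H. L2_closed_subspace M H \<longrightarrow> atomless M \<longrightarrow>
        vectorspace.fin_dim class_ring (L2_sub M H) \<longrightarrow> mu_dim M H = 0) \<and>
     (\<forall>H. L2_closed_subspace M H \<longrightarrow>
        (\<forall>X\<in>sets M. H = L2_indicator_proj M X ` carrier (L2 M) \<longrightarrow> mu_dim M H = measure M X)) \<and>
     (\<forall>J. finite (space M) \<longrightarrow> card (space M) = J \<longrightarrow>
        (\<forall>X. X \<subseteq> space M \<longrightarrow> X \<in> sets M \<and> measure M X = real (card X) / real J) \<longrightarrow>
        (\<forall>H. L2_subspace M H \<longrightarrow>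
           mu_dim M H = real (vectorspace.dim class_ring (L2_sub M H)) / real J))"
proof -
  interpret prob_space M by (rule assms)
  show ?thesis
    using mu_dim_fin_dim_atomless mu_dim_indicator_range mu_dim_uniform
    unfolding L2_closed_subspace_def by blast
qed

end
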